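(* Let $r$ be an odd integer with $r>1$ and $a$ an odd integer. For $k\ge1$ let $F_k$ be the $k\times k$ matrix with $2$ on the diagonal, $1$ on the first super- and subdiagonal and $0$ elsewhere, and $e_1$ the first standard basis column vector of appropriate size. (1) If $a\equiv1\pmod8$, the discriminant module of the positive definite even lattice with $1\times1$ Gram matrix $(2^r)$ is isometrically isomorphic to $\underline{A}_{2^r}^a$. (2) If $a\equiv3\pmod8$, let $v$ be an integer with $2^{r-1}v^2\equiv-8\pmod{19}$ and $x=\frac{2^{r-1}v^2+8}{19}$; then the discriminant module of the positive definite even lattice with $7\times7$ Gram matrix $\begin{pmatrix}19\cdot2^r & 2^rv & 0\\ 2^rv & 2x & e_1^{\mathrm T}\\ 0&e_1&F_5\end{pmatrix}$ is isometrically isomorphic to $\underline{A}_{2^r}^a$. (3) If $a\equiv5\pmod8$, let $v$ be an integer with $2^{r-1}v^2\equiv1\pmod5$ and $x=\frac{2^{r-1}v^2+39}{5}$; then the discriminant module of the positive definite even lattice with $9\times9$ Gram matrix $G=(g_{ij})$ given by $g_{11}=5\cdot2^r$, $g_{12}=g_{21}=2^rv$, $g_{22}=2x$, $g_{23}=g_{32}=7$, $g_{33}=4$, $g_{ii}=2$ for $4\le i\le9$, $g_{i,i+1}=g_{i+1,i}=1$ for $3\le i\le8$, and all other entries $0$, is isometrically isomorphic to $\underline{A}_{2^r}^a$. (4) If $a\equiv7\pmod8$, let $v$ be an integer with $2^{r-1}v^2\equiv-3\pmod7$ and $x=\frac{2^{r-1}v^2+3}{7}$; then the discriminant module of the positive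 definite even lattice with $7\times7$ Gram matrix $\begin{pmatrix}7\cdot2^r & 2^rv & 0\\ 2^rv & 2x & e_1^{\mathrm T}\\ 0&e_1&F_5\end{pmatrix}$ is isometrically isomorphic to $\underline{A}_{2^r}^a$. Moreover, in each case the rank of the given lattice is the least among all positive definite even lattices whose discriminant module is isometrically isomorphic to $\underline{A}_{2^r}^a$.
   Context: A lattice $(L,B)$ is a free $\mathbb{Z}$-module of finite rank with symmetric bilinear $B\colon L\times L\to\mathbb{R}$ whose Gram matrix has nonzero determinant; even means $B(x,y)\in\mathbb{Z}$, $B(x,x)\in2\mathbb{Z}$; positive definite means $B(x,x)>0$ for $x\ne0$. The lattice with Gram matrix $G$ is $\mathbb{Z}^n$ with $B(x,y)=x^{\mathrm T}Gy$. Dual lattice $L^\sharp=\{v\in\mathbb{R}\otimes L: B(v,w)\in\mathbb{Z}\ \forall w\in L\}$; discriminant module $D_L=(L^\sharp/L,\ v+L\mapsto\frac12B(v,v)+\mathbb{Z})$. Finite quadratic modules: finite abelian groups with $Q\colon M\to\mathbb{Q}/\mathbb{Z}$, $Q(nx)=n^2Q(x)$, $Q(x+y)-Q(x)-Q(y)$ bilinear nondegenerate; isometric isomorphism = group isomorphism preserving $Q$. $\underline{A}_{2^r}^a=(\mathbb{Z}/2^r\mathbb{Z},\ x+2^r\mathbb{Z}\mapsto\frac{a}{2^{r+1}}x^2+\mathbb{Z})$. *)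

theory Defs
  imports
    "HOL-Analysis.Analysis"
    "HOL-Algebra.Elementary_Groups"
    "HOL-Number_Theory.Cong"
begin

text \<open>
  A lattice is given by its \<open>\<int>\<close>-module \<open>L\<close>, embedded in a real vector space in such a way that
  some \<open>\<int>\<close>-basis of \<open>L\<close> is linearly independent over the reals, so that \<open>span L\<close> is
  \<open>\<real> \<otimes> L\<close>, together with (the real bilinear extension of) its form \<open>B\<close>. Requiring \<open>B\<close> to be
  bilinear and symmetric on the whole ambient type is no restriction, because every symmetric
  bilinear form on \<open>span L\<close> extends; values of \<open>B\<close> outside \<open>span L\<close> are never used below.
\<close>

definition int_basis :: "'v::real_vector set \<Rightarrow> 'v set \<Rightarrow> bool" where
  "int_basis S L \<longleftrightarrow> finite S \<and> independent S \<and>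
     L = {\<Sum>s\<in>S. of_int (c s) *\<^sub>R s | c :: 'v \<Rightarrow> int. True}"

text \<open>The Leibniz formula for the determinant of the Gram matrix with index set \<open>S\<close>.\<close>

definition gram_det :: "('v \<Rightarrow> 'v \<Rightarrow> real) \<Rightarrow> 'v set \<Rightarrow> real" where
  "gram_det B S = (\<Sum>p | p permutes S. of_int (sign p) * (\<Prod>s\<in>S. B s (p s)))"

definition lattice_form :: "'v::real_vector set \<Rightarrow> ('v \<Rightarrow> 'v \<Rightarrow> real) \<Rightarrow> bool" where
  "lattice_form L B \<longleftrightarrow> bilinear B \<and> (\<forall>x y. B x y = B y x) \<and>
     (\<exists>S. int_basis S L \<and> gram_det B S \<noteq> 0)"

definition lattice_rank :: "'v::real_vector set \<Rightarrow> nat" where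
  "lattice_rank L = (THE n. \<exists>S. int_basis S L \<and> card S = n)"

definition even_form :: "'v set \<Rightarrow> ('v \<Rightarrow> 'v \<Rightarrow> real) \<Rightarrow> bool" where
  "even_form L B \<longleftrightarrow> (\<forall>x\<in>L. \<forall>y\<in>L. B x y \<in> \<int>) \<and> (\<forall>x\<in>L. \<exists>k::int. B x x = 2 * of_int k)"

definition pos_def_form :: "'v::zero set \<Rightarrow> ('v \<Rightarrow> 'v \<Rightarrow> real) \<Rightarrow> bool" where
  "pos_def_form L B \<longleftrightarrow> (\<forall>x\<in>L. x \<noteq> 0 \<longrightarrow> B x x > 0)"

definition dual_lattice :: "'v::real_vector set \<Rightarrow> ('v \<Rightarrow> 'v \<Rightarrow> real) \<Rightarrow> 'v set" where
  "dual_lattice L B = {v \<in> span L. \<forall>w\<in>L. B v w \<in> \<int>}"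

text \<open>The class \<open>x + \<int>\<close> in \<open>\<real>/\<int>\<close>, of which \<open>\<rat>/\<int>\<close> is a subgroup.\<close>

definition mod_int :: "real \<Rightarrow> real set" where
  "mod_int x = {x + of_int k | k :: int. True}"

text \<open>A quadratic module is a group paired with its quadratic form.\<close>

type_synonym 'a quadratic_module = "'a monoid \<times> ('a \<Rightarrow> real set)"

definition isometric :: "'a quadratic_module \<Rightarrow> 'b quadratic_module \<Rightarrow> bool" where
  "isometric M N \<longleftrightarrow>
     (\<exists>f \<in> iso (fst M) (fst N). \<forall>x \<in> carrier (fst M). snd N (f x) = snd M x)"

text \<open>
  For an even lattice all \<open>v\<close> in a coset give the same class modulo \<open>\<int>\<close>, so that the union in
  the quadratic form is that class; see lemma \<open>disc_module_form\<close> below.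
\<close>

definition disc_module ::
  "'v::real_vector set \<Rightarrow> ('v \<Rightarrow> 'v \<Rightarrow> real) \<Rightarrow> 'v set quadratic_module" where
  "disc_module L B =
     (\<lparr>carrier = dual_lattice L B, mult = (+), one = 0\<rparr> Mod L,
      \<lambda>C. \<Union>v\<in>C. mod_int (B v v / 2))"

definition A_module :: "nat \<Rightarrow> int \<Rightarrow> int quadratic_module" where
  "A_module r a =
     (integer_mod_group (2 ^ r), \<lambda>x. mod_int (of_int a / 2 ^ (r + 1) * (of_int x)\<^sup>2))"

definition int_vectors :: "(real ^ 'n) set" where
  "int_vectors = {x. \<forall>i. x $ i \<in> \<int>}"

definition gram_form :: "real ^ 'n ^ 'n \<Rightarrow> real ^ 'n \<Rightarrow> real ^ 'n \<Rightarrow> real" where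
  "gram_form G x y = x \<bullet> (G *v y)"

definition pos_def_even_lattice_with_disc ::
  "'a quadratic_module \<Rightarrow> 'v::real_vector set \<Rightarrow> ('v \<Rightarrow> 'v \<Rightarrow> real) \<Rightarrow> bool" where
  "pos_def_even_lattice_with_disc M L B \<longleftrightarrow>
     lattice_form L B \<and> even_form L B \<and> pos_def_form L B \<and> isometric (disc_module L B) M"

definition gram1 :: "nat \<Rightarrow> real ^ 1 ^ 1" where
  "gram1 r = vector [vector [2 ^ r]]"

text \<open>The lower right \<open>5 \<times> 5\<close> block is \<open>F\<^sub>5\<close>.\<close>

definition gram7 :: "real \<Rightarrow> nat \<Rightarrow> int \<Rightarrow> real \<Rightarrow> real ^ 7 ^ 7" where
  "gram7 p r v x = vector [
     vector [p * 2 ^ r,      2 ^ r * of_int v, 0, 0, 0, 0, 0],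
     vector [2 ^ r * of_int v, 2 * x,          1, 0, 0, 0, 0],
     vector [0,                1,              2, 1, 0, 0, 0],
     vector [0,                0,              1, 2, 1, 0, 0],
     vector [0,                0,              0, 1, 2, 1, 0],
     vector [0,                0,              0, 0, 1, 2, 1],
     vector [0,                0,              0, 0, 0, 1, 2]]"

definition gram9 :: "nat \<Rightarrow> int \<Rightarrow> real \<Rightarrow> real ^ 9 ^ 9" where
  "gram9 r v x = vector [
     vector [5 * 2 ^ r,      2 ^ r * of_int v, 0, 0, 0, 0, 0, 0, 0],
     vector [2 ^ r * of_int v, 2 * x,          7, 0, 0, 0, 0, 0, 0],
     vector [0,                7,              4, 1, 0, 0, 0, 0, 0],
     vector [0,                0,              1, 2, 1, 0, 0, 0, 0],
     vector [0,                0,              0, 1, 2, 1, 0, 0, 0],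
     vector [0,                0,              0, 0, 1, 2, 1, 0, 0],
     vector [0,                0,              0, 0, 0, 1, 2, 1, 0],
     vector [0,                0,              0, 0, 0, 0, 1, 2, 1],
     vector [0,                0,              0, 0, 0, 0, 0, 1, 2]]"

lemma int_basis_rank:
  assumes "int_basis S L"
  shows "lattice_rank L = card S"
proof -
  have card_eq: "card T = dim L" if T: "int_basis T L" for T
  proof -
    have fin: "finite T" and ind: "independent T"
      and L: "L = {\<Sum>s\<in>T. of_int (c s) *\<^sub>R s | c. True}"
      using T by (auto simp: int_basis_def)
    have "T \<subseteq> L"
    proof
      fix t assume t: "t \<in> T"
      have "(\<Sum>s\<in>T. of_int (if s = t then 1 else 0) *\<^sub>R s) = (\<Sum>s\<in>T. if s = t then s else 0)"
        by (rule sum.cong) auto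
      also have "\<dots> = t" using fin t by simp
      finally have "t = (\<Sum>s\<in>T. of_int ((\<lambda>s. if s = t then 1 else 0) s) *\<^sub>R s)" by simp
      then show "t \<in> L" unfolding L mem_Collect_eq
        by (intro exI[of _ "\<lambda>s. if s = t then 1 else 0"]) simp
    qed
    moreover have "L \<subseteq> span T"
    proof
      fix x assume "x \<in> L"
      then obtain c :: "'a \<Rightarrow> int" where "x = (\<Sum>s\<in>T. of_int (c s) *\<^sub>R s)"
        unfolding L by blast
      then show "x \<in> span T" by (simp add: span_sum span_scale span_base)
    qed
    ultimately show ?thesis using ind by (metis dim_unique)
  qed
  show ?thesis unfolding lattice_rank_def
    using assms card_eq by (intro the_equality) auto
qed

lemma lattice_rank_int_vectors: "lattice_rank (int_vectors :: (real ^ 'n) set) = CARD('n)"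
proof -
  have "int_basis (Basis :: (real ^ 'n) set) int_vectors"
    unfolding int_basis_def
  proof (intro conjI finite_Basis independent_Basis subset_antisym subsetI)
    fix x :: "real ^ 'n" assume x: "x \<in> int_vectors"
    have "x \<bullet> b \<in> \<int>" if "b \<in> Basis" for b
      using x that by (auto simp: int_vectors_def Basis_vec_def inner_axis)
    then have "(\<Sum>b\<in>Basis. of_int \<lfloor>x \<bullet> b\<rfloor> *\<^sub>R b) = x"
      by (simp add: euclidean_representation cong: sum.cong)
    then show "x \<in> {\<Sum>b\<in>Basis. of_int (c b) *\<^sub>R b | c :: real ^ 'n \<Rightarrow> int. True}"
      unfolding mem_Collect_eq by (intro exI[of _ "\<lambda>b. \<lfloor>x \<bullet> b\<rfloor>"]) simp
  next
    fix x :: "real ^ 'n"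
    assume "x \<in> {\<Sum>b\<in>Basis. of_int (c b) *\<^sub>R b | c :: real ^ 'n \<Rightarrow> int. True}"
    then obtain c :: "real ^ 'n \<Rightarrow> int" where x: "x = (\<Sum>b\<in>Basis. of_int (c b) *\<^sub>R b)"
      by blast
    have "b $ i \<in> \<int>" if "b \<in> Basis" for b :: "real ^ 'n" and i
      using that by (auto simp: Basis_vec_def axis_def)
    then show "x \<in> int_vectors"
      by (auto simp: int_vectors_def x intro!: Ints_sum Ints_mult)
  qed
  from int_basis_rank[OF this] show ?thesis by simp
qed

lemma disc_module_form:
  assumes "lattice_form L B" "even_form L B" "v \<in> dual_lattice L B"
  shows "snd (disc_module L B) (L #>\<^bsub>\<lparr>carrier = dual_lattice L B, mult = (+), one = 0\<rparr>\<^esub> v)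
    = mod_int (B v v / 2)"
proof -
  have bil: "bilinear B" and sym: "\<And>x y. B x y = B y x"
    using assms(1) by (auto simp: lattice_form_def)
  obtain S where S: "int_basis S L" using assms(1) by (auto simp: lattice_form_def)
  have "0 \<in> {\<Sum>s\<in>S. of_int (c s) *\<^sub>R s | c. True}"
    unfolding mem_Collect_eq by (intro exI[of _ "\<lambda>_. 0"]) simp
  then have zero: "0 \<in> L" using S by (simp add: int_basis_def)
  have eq: "mod_int (B (w + v) (w + v) / 2) = mod_int (B v v / 2)" if w: "w \<in> L" for w
  proof -
    obtain k :: int where k: "B w w = 2 * of_int k" using assms(2) w by (auto simp: even_form_def)
    have "B v w \<in> \<int>" using assms(3) w by (auto simp: dual_lattice_def)
    then obtain l :: int where l: "B v w = of_int l" by (auto elim: Ints_cases)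
    have val: "B (w + v) (w + v) / 2 = B v v / 2 + of_int (k + l)"
      using sym[of w v] k l by (simp add: bilinear_ladd[OF bil] bilinear_radd[OF bil] field_simps)
    have "\<exists>j'. B v v / 2 + of_int (k + l) + of_int j = B v v / 2 + of_int j'" for j :: int
      by (rule exI[of _ "k + l + j"]) simp
    moreover have "\<exists>j'. B v v / 2 + of_int j = B v v / 2 + of_int (k + l) + of_int j'" for j :: int
      by (rule exI[of _ "j - (k + l)"]) simp
    ultimately show ?thesis unfolding mod_int_def val by blast
  qed
  then show ?thesis using zero
    by (auto simp: disc_module_def r_coset_def)
qed

text \<open>The congruence conditions imposed on \<open>v\<close> are solvable.\<close>

lemma ex_admissible:
  fixes r :: nat
  assumes "odd r"
  shows "\<exists>v::int. [2 ^ (r - 1) * v\<^sup>2 = -8] (mod 19)"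
    and "\<exists>v::int. [2 ^ (r - 1) * v\<^sup>2 = 1] (mod 5)"
    and "\<exists>v::int. [2 ^ (r - 1) * v\<^sup>2 = -3] (mod 7)"
proof -
  obtain m where r: "r - 1 = 2 * m" using assms by (auto elim: oddE)
  have sq: "2 ^ (r - 1) * (c * d ^ m)\<^sup>2 = c\<^sup>2 * ((2 * d)\<^sup>2) ^ m" for c d :: int
  proof -
    have "((2 * d)\<^sup>2) ^ m = 2 ^ (2 * m) * d ^ (2 * m)"
      by (simp only: power_mult_distrib flip: power_mult)
    moreover have "(c * d ^ m)\<^sup>2 = c\<^sup>2 * d ^ (2 * m)"
      by (simp only: power_mult_distrib power_even_eq)
    ultimately show ?thesis unfolding r by (simp only: mult.left_commute)
  qed
  have cong: "[2 ^ (r - 1) * (c * d ^ m)\<^sup>2 = c\<^sup>2] (mod n)" if "[(2 * d)\<^sup>2 = 1] (mod n)" for c d n :: int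
    unfolding sq using cong_mult[OF cong_refl cong_pow[OF that], of "c\<^sup>2" m] by simp
  show "\<exists>v::int. [2 ^ (r - 1) * v\<^sup>2 = -8] (mod 19)"
    using cong[of 10 19 7] by (intro exI[of _ "7 * 10 ^ m"]) (simp add: cong_def)
  show "\<exists>v::int. [2 ^ (r - 1) * v\<^sup>2 = 1] (mod 5)"
    using cong[of 3 5 1] by (intro exI[of _ "1 * 3 ^ m"]) (simp add: cong_def)
  show "\<exists>v::int. [2 ^ (r - 1) * v\<^sup>2 = -3] (mod 7)"
    using cong[of 4 7 2] by (intro exI[of _ "2 * 4 ^ m"]) (simp add: cong_def)
qed

end

theory Submission
  imports Defs "HOL-Library.Real_Mod"
begin

text \<open>
  \<^emph>\<open>Lower bounds on the rank.\<close> An even positive definite lattice \<open>L\<close> of rank \<open>n\<close> contains an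
  orthogonal sublattice of full rank, and the Gauss sum of its discriminant form is, up to a
  positive factor, that of this sublattice (orthogonality of characters). The latter is a
  product of \<open>n\<close> one-dimensional Gauss sums, each a positive multiple of \<open>1 + \<i>\<close>. On the other
  hand the Gauss sum of \<open>A_module r a\<close> with \<open>r\<close> odd is a positive multiple of \<open>1 + \<i> ^ a\<close>, so \<open>n\<close>
  is 1 or 7 modulo 8. For \<open>a\<close> congruent to 5 modulo 8 rank 1 is excluded because 5 is not a square
  modulo 8.

  \<^emph>\<open>The given lattices.\<close> The first basis vector divided by \<open>2 ^ r\<close> generates the dual lattice modulo
  the lattice, and its norm is \<open>p / 2 ^ r\<close> with \<open>p\<close> congruent to \<open>a\<close> modulo 8; the quotient \<open>a / p\<close>
  is then a square modulo every power of 2.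
\<close>

section \<open>Quadratic Gauss sums\<close>

text \<open>The modulus of a quadratic Gauss sum is elementary, but the rank is read off from a
  direction in the complex plane, so the sign is needed; this is the one analytic ingredient. It is
  needed only for coefficient 1, since a vector of norm 2m in an orthogonal sublattice contributes
  the sum of e(x^2 / (4m)). The sum for \<open>A_module r a\<close> needs no analysis: for odd r the
  order 2^r is twice a square, and scaling reduces it to the two terms 1 + i^a.

  The constants in the Gram matrices make the determinant equal to 2^r. The chain F_k has
  determinant k + 1. With p in the corner and p x = 2^(r-1) v^2 + c, expansion along the first two
  rows gives 2^r (12 c - 5 p) in rank 7, where 6 and 5 are the determinants of F_5 and F_4; the
  pairs (p, c) = (19, 8) and (7, 3) make the bracket 1. In rank 9 the chain headed by 4 has
  determinant 4 * 7 - 6 = 22, and the entry 7 is weighted by det F_6 = 7, so the bracket is 44 c -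
  343 p, which is 1 for (5, 39). The same equation yields both positivity and the integrality of
  dual coordinates.\<close>

definition ee :: "real \<Rightarrow> complex" where
  "ee x = cis (2 * pi * x)"

lemma ee_add: "ee (x + y) = ee x * ee y"
  by (simp add: ee_def cis_mult distrib_left)

lemma ee_0 [simp]: "ee 0 = 1"
  by (simp add: ee_def)

lemma norm_ee [simp]: "norm (ee x) = 1"
  by (simp add: ee_def)

lemma ee_eq_1_iff: "ee x = 1 \<longleftrightarrow> x \<in> \<int>"
proof -
  have "ee x = 1 \<longleftrightarrow> (\<exists>n. x = of_int n)"
    by (auto simp: ee_def cis_eq_1_iff)
  then show ?thesis by (auto elim: Ints_cases)
qed

lemma ee_of_int [simp]: "ee (of_int n) = 1"
  by (simp add: ee_eq_1_iff)

lemma ee_add_Ints: "k \<in> \<int> \<Longrightarrow> ee (x + k) = ee x"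
  using ee_eq_1_iff[of k] by (simp add: ee_add)

lemma ee_cong: "x - y \<in> \<int> \<Longrightarrow> ee x = ee y"
  using ee_add_Ints[of "x - y" y] by simp

lemma ee_power: "ee x ^ n = ee (real n * x)"
  by (induction n) (simp_all add: ee_add distrib_right)

lemma ee_prod: "finite A \<Longrightarrow> ee (sum f A) = (\<Prod>i\<in>A. ee (f i))"
  by (induction A rule: finite_induct) (simp_all add: ee_add)

text \<open>A chord is at most as long as its arc. This serves to compare two Gauss sums with nearby
  moduli term by term.\<close>

lemma norm_ee_diff_le: "norm (ee x - ee y) \<le> 2 * pi * \<bar>x - y\<bar>"
proof -
  have "norm (ee x - ee y) = norm (ee y * (ee (x - y) - 1))"
    by (simp add: right_diff_distrib flip: ee_add)
  also have "\<dots> = norm (exp (\<i> * (2 * pi * (x - y))) - 1)"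
    by (simp add: norm_mult ee_def cis_conv_exp)
  also have "\<dots> = 2 * \<bar>sin (2 * pi * (x - y) / 2)\<bar>"
    by (metis dist_exp_i_1 of_real_mult of_real_diff of_real_numeral)
  also have "\<dots> \<le> 2 * \<bar>2 * pi * (x - y) / 2\<bar>"
    using abs_sin_x_le_abs_x by (intro mult_left_mono) auto
  also have "\<dots> = 2 * pi * \<bar>x - y\<bar>" by (simp add: abs_mult)
  finally show ?thesis .
qed

lemma sum_ee_multiples:
  fixes c :: int and k :: nat
  assumes "k > 0"
  shows "(\<Sum>z<k. ee (of_int c * real z / real k)) = (if int k dvd c then of_nat k else 0)"
proof -
  let ?q = "ee (of_int c / real k)"
  have q: "ee (of_int c * real z / real k) = ?q ^ z" for z
    by (simp add: ee_power mult.commute)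
  have q1: "?q = 1 \<longleftrightarrow> int k dvd c"
  proof -
    have "of_int c / real k \<in> \<int> \<longleftrightarrow> int k dvd c"
      using of_int_div_of_int_in_Ints_iff[of c "int k", where ?'a=real] assms by simp
    then show ?thesis by (simp add: ee_eq_1_iff)
  qed
  have "?q ^ k = 1" using assms by (simp add: ee_power ee_eq_1_iff)
  then have "?q \<noteq> 1 \<Longrightarrow> (\<Sum>z<k. ?q ^ z) = 0" by (simp add: geometric_sum)
  then show ?thesis using q1 by (auto simp: q)
qed

text \<open>The summand has period \<open>2 * m\<close> in \<open>x\<close>. For
  \<open>a = 1\<close> this is the Gauss sum of the discriminant form of the rank one lattice
  generated by a vector of norm \<open>2 * m\<close>.\<close>

definition gauss_sum :: "int \<Rightarrow> nat \<Rightarrow> complex" where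
  "gauss_sum a m = (\<Sum>x<2 * m. ee (of_int a * (real x)\<^sup>2 / (4 * real m)))"

text \<open>Write the summation variable as \<open>y + z * ?K\<close>. Modulo integers the phase is
  linear in \<open>z\<close>, so the sum over \<open>z\<close> is a full character sum modulo
  \<open>k\<close>. As \<open>a\<close> is prime to \<open>k\<close>, it kills every
  \<open>y\<close> that is not a multiple of \<open>k\<close>, and the surviving
  \<open>y = w * k\<close> reproduce the summands for \<open>m\<close>.\<close>

lemma gauss_sum_mult_square:
  assumes m: "m > 0" and k: "k > 0" and cop: "coprime a (int k)"
  shows "gauss_sum a (m * k\<^sup>2) = of_nat k * gauss_sum a m"
proof -
  let ?f = "\<lambda>x::nat. ee (of_int a * (real x)\<^sup>2 / (4 * real (m * k\<^sup>2)))"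
  let ?K = "2 * m * k"
  have split: "?f (y + z * ?K) = ?f y * ee (of_int (a * int y) * real z / real k)" for y z
  proof -
    have "of_int a * (real (y + z * ?K))\<^sup>2 / (4 * real (m * k\<^sup>2))
       = of_int a * (real y)\<^sup>2 / (4 * real (m * k\<^sup>2)) + of_int (a * int y) * real z / real k
         + of_int (a * int m * int z * int z)"
      using m k by (simp add: field_simps power2_eq_square)
    then show ?thesis by (simp only: ee_add ee_of_int mult_1_right)
  qed
  have "gauss_sum a (m * k\<^sup>2) = sum ?f {..<k * ?K}"
    by (simp add: gauss_sum_def power2_eq_square mult_ac)
  also have "\<dots> = (\<Sum>z<k. sum ?f {z * ?K..<z * ?K + ?K})"
    by (rule sum.nat_group[symmetric])
  also have "\<dots> = (\<Sum>z<k. \<Sum>y<?K. ?f (y + z * ?K))"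
  proof (rule sum.cong[OF refl])
    fix z
    show "sum ?f {z * ?K..<z * ?K + ?K} = (\<Sum>y<?K. ?f (y + z * ?K))"
      using sum.shift_bounds_nat_ivl[of ?f 0 "z * ?K" ?K]
      unfolding atLeast0LessThan add_0 add.commute[of ?K "z * ?K"] .
  qed
  also have "\<dots> = (\<Sum>y<?K. \<Sum>z<k. ?f y * ee (of_int (a * int y) * real z / real k))"
    unfolding split by (rule sum.swap)
  also have "\<dots> = (\<Sum>y<?K. ?f y * (if k dvd y then of_nat k else 0))"
  proof (intro sum.cong refl)
    fix y
    have "int k dvd a * int y \<longleftrightarrow> k dvd y"
      using cop by (simp add: coprime_commute coprime_dvd_mult_right_iff)
    then show "(\<Sum>z<k. ?f y * ee (of_int (a * int y) * real z / real k))
        = ?f y * (if k dvd y then of_nat k else 0)"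
      unfolding sum_distrib_left[symmetric] sum_ee_multiples[OF k, of "a * int y"] by simp
  qed
  \<comment> \<open>The range of \<open>y\<close> is cut into \<open>2 * m\<close> blocks of length
    \<open>k\<close>; the only multiple of \<open>k\<close> in a block is its first element.\<close>
  also have "\<dots> = (\<Sum>w<2*m. \<Sum>y\<in>{w * k..<w * k + k}. ?f y * (if k dvd y then of_nat k else 0))"
    by (rule sum.nat_group[symmetric])
  also have "\<dots> = (\<Sum>w<2*m. ?f (w * k) * of_nat k)"
  proof (intro sum.cong refl)
    fix w
    have "k dvd y \<longleftrightarrow> y = w * k" if "y \<in> {w * k..<w * k + k}" for y
    proof
      assume "k dvd y"
      then obtain u where u: "y = u * k" by (auto simp: dvd_def mult.commute)
      with that have "w * k \<le> u * k" "u * k < (w + 1) * k" by auto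
      then have "w \<le> u" "u < w + 1" using k by (auto simp only: mult_le_cancel2 mult_less_cancel2)
      then show "y = w * k" using u by simp
    qed simp
    then have "(\<Sum>y\<in>{w * k..<w * k + k}. ?f y * (if k dvd y then of_nat k else 0))
        = (\<Sum>y\<in>{w * k..<w * k + k}. if y = w * k then ?f y * of_nat k else 0)"
      by (intro sum.cong) auto
    also have "\<dots> = ?f (w * k) * of_nat k" using k by simp
    finally show "(\<Sum>y\<in>{w * k..<w * k + k}. ?f y * (if k dvd y then of_nat k else 0))
        = ?f (w * k) * of_nat k" .
  qed
  also have "\<dots> = of_nat k * gauss_sum a m"
    using k by (simp add: gauss_sum_def sum_distrib_left power_mult_distrib mult.commute)
  finally show ?thesis .
qed

lemma gauss_sum_1: "gauss_sum a 1 = 1 + ee (of_int a / 4)"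
proof -
  have "{..<2::nat} = {0, 1}" by auto
  then show ?thesis by (simp add: gauss_sum_def)
qed

lemma ee_quarter: "ee (1 / 4) = \<i>"
  by (simp add: ee_def)

section \<open>The Kusmin-Landau estimate and the sign of the Gauss sum\<close>

lemma cis_minus_one_cot:
  assumes "sin y \<noteq> 0"
  shows "(cis (2 * y) - 1) * (- (1 / 2) - \<i> * of_real (cot y / 2)) = 1"
proof -
  have "(cos (2 * y) - 1) * (- 1 / 2) + sin (2 * y) * (cot y / 2) = (sin y)\<^sup>2 + (cos y)\<^sup>2"
    unfolding cos_double_sin sin_double using assms by (simp add: cot_def power2_eq_square)
  then have "Re ((cis (2 * y) - 1) * (- (1 / 2) - \<i> * of_real (cot y / 2))) = 1"
    by simp
  moreover have "(cos (2 * y) - 1) * (cot y / 2) + sin (2 * y) / 2 = 0"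
    unfolding cos_double_sin sin_double using assms by (simp add: cot_def power2_eq_square)
  then have "Im ((cis (2 * y) - 1) * (- (1 / 2) - \<i> * of_real (cot y / 2))) = 0"
    by simp
  ultimately show ?thesis by (simp only: complex_eq_iff one_complex.simps)
qed

lemma cot_antimono:
  assumes "0 < x" "x \<le> y" "y < pi / 2"
  shows "cot y \<le> cot x"
proof -
  have "0 < tan x" "tan x \<le> tan y"
    using assms tan_gt_zero[of x] tan_mono_le[of x y] by auto
  then show ?thesis by (simp add: cot_altdef le_imp_inverse_le)
qed

text \<open>Equivalent to \<open>x \<le> tan x\<close>, which holds because \<open>tan y - y\<close>
  has the nonnegative derivative 1 / cos^2 - 1.\<close>

lemma cot_le_inverse:
  assumes "0 < x" "x < pi / 2"
  shows "cot x \<le> 1 / x"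
proof -
  have "x \<le> tan x"
  proof -
    have "(\<lambda>y. tan y - y) 0 \<le> (\<lambda>y. tan y - y) x"
    proof (rule DERIV_nonneg_imp_nondecreasing[where f = "\<lambda>y. tan y - y"])
      fix y assume y: "0 \<le> y" "y \<le> x"
      then have c: "cos y > 0" using assms by (intro cos_gt_zero_pi) auto
      then have "((\<lambda>y. tan y - y) has_real_derivative (inverse ((cos y)\<^sup>2) - 1)) (at y)"
        by (auto intro!: derivative_eq_intros)
      moreover have "(cos y)\<^sup>2 \<le> 1" by (simp add: abs_square_le_1)
      then have "inverse ((cos y)\<^sup>2) \<ge> 1" using c by (simp add: one_le_inverse)
      ultimately show "\<exists>l. ((\<lambda>y. tan y - y) has_real_derivative l) (at y) \<and> 0 \<le> l" by force
    qed (use assms in auto)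
    then show ?thesis by simp
  qed
  then show ?thesis using le_imp_inverse_le[of x "tan x"] assms by (simp add: cot_altdef inverse_eq_divide)
qed

text \<open>
  The Kusmin--Landau bound: dividing the differences of consecutive terms by \<open>ee \<delta> - 1\<close> turns
  the sum into a telescoping one, up to the total variation of a monotone cotangent.
\<close>

lemma norm_sum_ee_squares_le:
  fixes X N :: nat
  assumes X: "1 \<le> X" "X < N"
  shows "norm (\<Sum>x=X..<N. ee ((real x)\<^sup>2 / (4 * real N))) \<le> 2 * real N / real X"
proof -
  define E where "E x = ee ((real x)\<^sup>2 / (4 * real N))" for x :: nat
  \<comment> \<open>Half the angle from \<open>E x\<close> to \<open>E (Suc x)\<close>, as (x+1)^2 -
    x^2 = 2x + 1. It is below pi / 2 just for \<open>x < N\<close>, which is why the estimate covers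
    only half a period.\<close>
  define d where "d x = pi * (2 * real x + 1) / (4 * real N)" for x :: nat
  \<comment> \<open>The inverse of \<open>cis (2 * d x) - 1\<close>, by
    \<open>cis_minus_one_cot\<close>. Its real part is constant, so \<open>c\<close> varies only
    through half a cotangent.\<close>
  define c where "c x = - (1 / 2) - \<i> * complex_of_real (cot (d x) / 2)" for x
  have d: "0 < d x" "d x < pi / 2" if "x < N" for x
  proof -
    show "0 < d x" using that by (auto simp: d_def intro!: divide_pos_pos mult_pos_pos)
    have "(2 * real x + 1) / (4 * real N) < 1 / 2" using that by (simp add: divide_simps)
    then have "pi * ((2 * real x + 1) / (4 * real N)) < pi * (1 / 2)"
      by (rule mult_strict_left_mono) simp
    then show "d x < pi / 2" by (simp add: d_def)
  qed
  have dmono: "d x \<le> d y" if "x \<le> y" for x y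
    using that by (auto simp: d_def intro!: divide_right_mono mult_left_mono)
  have cot0: "0 \<le> cot (d x)" if "x < N" for x
    using d[OF that] cot_gt_zero by (simp add: less_imp_le)
  have E_step: "E x = c x * (E (Suc x) - E x)" if "x < N" for x
  proof -
    have "E (Suc x) = E x * cis (2 * d x)"
    proof -
      have "(real (Suc x))\<^sup>2 / (4 * real N) = (real x)\<^sup>2 / (4 * real N) + (2 * real x + 1) / (4 * real N)"
        by (simp add: power2_eq_square field_simps flip: add_divide_distrib)
      then show ?thesis unfolding E_def by (simp add: ee_add) (simp add: ee_def d_def)
    qed
    moreover have "sin (d x) \<noteq> 0" using d[OF that] sin_gt_zero[of "d x"] by auto
    note cis_minus_one_cot[OF this]
    ultimately show ?thesis unfolding c_def[symmetric] by (simp add: algebra_simps)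
  qed
  have norm_c: "norm (c x) \<le> 1 / 2 + cot (d x) / 2" if "x < N" for x
  proof -
    have "norm (c x) \<le> norm (- (1 / 2) :: complex) + norm (\<i> * complex_of_real (cot (d x) / 2))"
      unfolding c_def by (rule norm_triangle_ineq4)
    then show ?thesis using cot0[OF that] by (simp add: norm_mult)
  qed
  \<comment> \<open>Summation by parts, with the boundary term at the upper end subtracted. The
    first term costs at most 1/2 + cot (d X) / 2, the bound for the norm of \<open>c X\<close>; each
    later one costs half the drop of the cotangent, and these drops telescope.\<close>
  have tele: "norm ((\<Sum>x=X..<Suc Y. E x) - c Y * E (Suc Y)) \<le> 1 / 2 + cot (d X) - cot (d Y) / 2"
    if "X \<le> Y" "Y < N" for Y
    using that
  proof (induction Y rule: dec_induct)
    case base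
    have "(\<Sum>x=X..<Suc X. E x) - c X * E (Suc X) = - (c X * E X)"
      using E_step[of X] base by (simp add: algebra_simps)
    then have "norm ((\<Sum>x=X..<Suc X. E x) - c X * E (Suc X)) = norm (c X)"
      by (simp add: norm_mult E_def)
    then show ?case using norm_c[of X] base by simp
  next
    case (step Y)
    have "(\<Sum>x=X..<Suc (Suc Y). E x) - c (Suc Y) * E (Suc (Suc Y))
        = ((\<Sum>x=X..<Suc Y. E x) - c Y * E (Suc Y)) + (c Y - c (Suc Y)) * E (Suc Y)"
      using E_step[of "Suc Y"] step by (simp add: algebra_simps)
    then have "norm ((\<Sum>x=X..<Suc (Suc Y). E x) - c (Suc Y) * E (Suc (Suc Y)))
        \<le> norm ((\<Sum>x=X..<Suc Y. E x) - c Y * E (Suc Y)) + norm ((c Y - c (Suc Y)) * E (Suc Y))"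
      by (metis norm_triangle_ineq)
    also have "norm ((c Y - c (Suc Y)) * E (Suc Y)) = (cot (d Y) - cot (d (Suc Y))) / 2"
    proof -
      have "c Y - c (Suc Y) = - \<i> * complex_of_real ((cot (d Y) - cot (d (Suc Y))) / 2)"
        by (simp add: c_def field_simps)
      moreover have "cot (d (Suc Y)) \<le> cot (d Y)"
        using step d by (intro cot_antimono dmono) auto
      ultimately show ?thesis by (simp add: norm_mult E_def del: of_real_diff of_real_divide)
    qed
    finally have "norm ((\<Sum>x=X..<Suc (Suc Y). E x) - c (Suc Y) * E (Suc (Suc Y)))
        \<le> norm ((\<Sum>x=X..<Suc Y. E x) - c Y * E (Suc Y)) + (cot (d Y) - cot (d (Suc Y))) / 2" .
    moreover have "norm ((\<Sum>x=X..<Suc Y. E x) - c Y * E (Suc Y)) \<le> 1 / 2 + cot (d X) - cot (d Y) / 2"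
      using step by simp
    ultimately show ?case unfolding diff_divide_distrib by linarith
  qed
  obtain Y where Y: "N = Suc Y" "X \<le> Y" using X by (cases N) auto
  have "norm (\<Sum>x=X..<N. E x) \<le> norm ((\<Sum>x=X..<Suc Y. E x) - c Y * E (Suc Y)) + norm (c Y * E (Suc Y))"
    unfolding Y(1) by (metis diff_add_cancel norm_triangle_ineq)
  also have "\<dots> \<le> (1 / 2 + cot (d X) - cot (d Y) / 2) + (1 / 2 + cot (d Y) / 2)"
    using tele[of Y] norm_c[of Y] Y by (intro add_mono) (auto simp: norm_mult E_def)
  also have "\<dots> = 1 + cot (d X)" by simp
  also have "cot (d X) \<le> 1 / d X" using d X by (intro cot_le_inverse) auto
  also have "1 / d X \<le> real N / real X"
  proof -
    have "real X * 4 \<le> pi * (2 * real X + 1)"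
      using mult_mono[of 2 pi "2 * real X" "2 * real X + 1"] pi_gt3 by simp
    then have "real N * (real X * 4) \<le> real N * (pi * (2 * real X + 1))"
      by (rule mult_left_mono) simp
    then show ?thesis using X by (simp add: d_def divide_simps mult_ac)
  qed
  also have "1 \<le> real N / real X" using X by simp
  finally show ?thesis by (simp add: E_def)
qed

text \<open>Reflecting \<open>x\<close> to \<open>2 * N - x\<close> changes the exponent by the
  integer \<open>N - x\<close>. So the full period is twice its first half, up to two end terms of
  norm 1, and the part of that half beyond \<open>X\<close> is small by the previous
  estimate.\<close>

lemma gauss_sum_approx:
  fixes X N :: nat
  assumes X: "1 \<le> X" "X < N"
  shows "norm (gauss_sum 1 N - 2 * (\<Sum>x<X. ee ((real x)\<^sup>2 / (4 * real N)))) \<le> 2 + 4 * real N / real X"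
proof -
  let ?E = "\<lambda>x::nat. ee ((real x)\<^sup>2 / (4 * real N))"
  have refl_E: "?E (2 * N - y) = ?E y" if "y \<le> 2 * N" for y
  proof -
    have "(real (2 * N - y))\<^sup>2 / (4 * real N) = (real y)\<^sup>2 / (4 * real N) + of_int (int N - int y)"
      using that X by (simp add: of_nat_diff power2_eq_square field_simps)
    then show ?thesis by (metis ee_add_Ints Ints_of_int)
  qed
  have "(\<Sum>x=N..<2*N. ?E x) = (\<Sum>y=1..N. ?E y)"
    by (rule sum.reindex_bij_witness[of _ "\<lambda>y. 2 * N - y" "\<lambda>y. 2 * N - y"])
      (use refl_E in auto)
  also have "\<dots> = (\<Sum>y<N. ?E y) - 1 + ?E N"
    using X sum.atLeast1_atMost_eq[of ?E N] sum.lessThan_Suc_shift[of ?E N]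
    by (simp add: algebra_simps)
  finally have second: "(\<Sum>x=N..<2*N. ?E x) = (\<Sum>y<N. ?E y) - 1 + ?E N" .
  have "gauss_sum 1 N = (\<Sum>x<N. ?E x) + (\<Sum>x=N..<2*N. ?E x)"
    unfolding gauss_sum_def
    by (subst sum.atLeastLessThan_concat[of 0 N "2*N", unfolded atLeast0LessThan]) auto
  moreover have "(\<Sum>x<N. ?E x) = (\<Sum>x<X. ?E x) + (\<Sum>x=X..<N. ?E x)"
    using X by (subst sum.atLeastLessThan_concat[of 0 X N, unfolded atLeast0LessThan]) auto
  ultimately have "gauss_sum 1 N - 2 * (\<Sum>x<X. ?E x) = 2 * (\<Sum>x=X..<N. ?E x) + (?E N - 1)"
    by (simp add: second)
  then have "norm (gauss_sum 1 N - 2 * (\<Sum>x<X. ?E x)) \<le> norm (2 * (\<Sum>x=X..<N. ?E x)) + norm (?E N - 1)"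
    by (metis norm_triangle_ineq)
  also have "norm (?E N - 1) \<le> 2"
    by (metis norm_triangle_ineq4 norm_ee norm_one one_add_one)
  finally show ?thesis using norm_sum_ee_squares_le[OF X] by (simp add: norm_mult)
qed

text \<open>
  Since \<open>gauss_sum 1 (m * k\<^sup>2) = k * gauss_sum 1 m\<close>, it suffices to compare the sums for
  \<open>m * k\<^sup>2\<close> and for the largest square \<open>k'\<^sup>2\<close> below it as \<open>k\<close> tends to infinity. With \<open>k = j ^ 4\<close>,
  cutting off at \<open>j ^ 5\<close> makes both the tails and the difference of the heads \<open>O(j\<^sup>3)\<close>.
\<close>

theorem gauss_sum_eval:
  assumes m: "m > 0"
  shows "gauss_sum 1 m = of_real (sqrt (real m)) * (1 + \<i>)"
proof -
  define G where "G = gauss_sum 1 1"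
  define C where "C = 20 * real m + norm G"
  let ?d = "gauss_sum 1 m - of_real (sqrt (real m)) * G"
  have bound: "norm ?d \<le> C / real j" if j: "j \<ge> 2" for j :: nat
  proof -
    define k where "k = j ^ 4"
    define X where "X = j ^ 5"
    define s where "s = sqrt (real m) * real k"
    define k' where "k' = nat \<lfloor>s\<rfloor>"
    define N where "N = m * k\<^sup>2"
    define N' where "N' = 1 * k'\<^sup>2"
    have k: "k > 0" using j by (simp add: k_def)
    have s0: "0 \<le> s" by (simp add: s_def)
    have s1: "real k \<le> s" using mult_right_mono[of 1 "sqrt (real m)" "real k"] m by (simp add: s_def)
    have k'1: "real k' \<le> s" using s0 by (simp add: k'_def of_nat_floor)
    have k'2: "s < real k' + 1" using s0 unfolding k'_def by linarith
    have kk': "k \<le> k'" using s1 by (simp add: k'_def le_nat_floor)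
    have k': "k' > 0" using k kk' by simp
    have NX: "X < N'"
    proof -
      have "j ^ 5 < j ^ 8" using j by (intro power_strict_increasing) auto
      also have "\<dots> = k\<^sup>2" by (simp add: k_def flip: power_mult)
      also have "\<dots> \<le> k'\<^sup>2" using kk' by (simp add: power_mono)
      finally show ?thesis by (simp add: X_def N'_def)
    qed
    have sN: "real N = s\<^sup>2" by (simp add: N_def s_def power_mult_distrib)
    have N'N: "N' \<le> N"
    proof -
      have "real N' \<le> real N" using k'1 by (simp add: sN N'_def power_mono)
      then show ?thesis by simp
    qed
    have X1: "1 \<le> X" using j by (simp add: X_def)
    \<comment> \<open>\<open>s\<close> is the square root of \<open>N\<close> and exceeds
      \<open>k'\<close> by less than 1, so \<open>N - N'\<close> has only the order of
      \<open>k\<close>, while both numbers are at least \<open>k\<^sup>2\<close>.\<close>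
    have gap: "real N - real N' \<le> 2 * real m * real k"
    proof -
      have "real N - real N' = (s - real k') * (s + real k')"
        by (simp add: sN N'_def power2_eq_square algebra_simps)
      also have "\<dots> \<le> 1 * (2 * s)" using k'1 k'2 s0 by (intro mult_mono) auto
      also have "s \<le> real m * real k"
      proof -
        have "sqrt (real m) \<le> real m" using m
          by (intro real_le_lsqrt) (auto simp: power2_eq_square)
        then show ?thesis unfolding s_def by (intro mult_right_mono) auto
      qed
      finally show ?thesis by simp
    qed
    have NX_eq: "real N / real X = real m * real j ^ 3"
    proof -
      have "real N = real m * real j ^ 3 * real X"
        by (simp add: N_def X_def k_def power_mult[symmetric] power_add[symmetric] mult.assoc)
      then show ?thesis using X1 by simp
    qed
    have N'X: "real N' / real X \<le> real m * real j ^ 3"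
      using N'N unfolding NX_eq[symmetric] by (simp add: divide_right_mono)
    let ?H = "\<lambda>N. \<Sum>x<X. ee ((real x)\<^sup>2 / (4 * real N))"
    \<comment> \<open>Each of the \<open>X\<close> phases moves by at most X^2 (N - N') / (4 N N'),
      which is of order m X^2 / k^3; summed over \<open>X\<close> terms this is of order m j^3. The
      constant 4 comes from \<open>pi < 4\<close>.\<close>
    have head: "norm (?H N - ?H N') \<le> 4 * real m * real j ^ 3"
    proof -
      have Nk: "real k ^ 2 \<le> real N" "real k ^ 2 \<le> real N'"
        using m kk' s1 by (auto simp: sN N'_def power_mono)
      have "norm (?H N - ?H N') \<le> (\<Sum>x<X. norm (ee ((real x)\<^sup>2 / (4 * real N)) - ee ((real x)\<^sup>2 / (4 * real N'))))"
        by (simp flip: sum_subtractf add: norm_sum)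
      also have "\<dots> \<le> (\<Sum>x<X. 4 * real m * real j ^ 3 / real X)"
      proof (rule sum_mono)
        fix x assume "x \<in> {..<X}"
        then have xX: "(real x)\<^sup>2 \<le> (real X)\<^sup>2" by (intro power_mono) auto
        have pos: "real N > 0" "real N' > 0" using NX N'N by auto
        have "norm (ee ((real x)\<^sup>2 / (4 * real N)) - ee ((real x)\<^sup>2 / (4 * real N')))
           \<le> 2 * pi * \<bar>(real x)\<^sup>2 / (4 * real N) - (real x)\<^sup>2 / (4 * real N')\<bar>"
          by (rule norm_ee_diff_le)
        also have "(real x)\<^sup>2 / (4 * real N) - (real x)\<^sup>2 / (4 * real N')
            = - ((real x)\<^sup>2 * (real N - real N') / (4 * (real N * real N')))"
          using pos by (simp add: field_simps)
        also have "2 * pi * \<bar>- ((real x)\<^sup>2 * (real N - real N') / (4 * (real N * real N')))\<bar>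
            = 2 * pi * ((real x)\<^sup>2 * (real N - real N') / (4 * (real N * real N')))"
          using N'N by (simp add: abs_mult)
        also have "\<dots> \<le> 2 * 4 * ((real X)\<^sup>2 * (2 * real m * real k) / (4 * (real k ^ 2 * real k ^ 2)))"
          using pi_less_4 k xX gap N'N Nk pos
          by (intro mult_mono frac_le divide_nonneg_nonneg mult_nonneg_nonneg) auto
        also have "\<dots> = 4 * real m * real j ^ 3 / real X"
        proof -
          have "(real X)\<^sup>2 * real k * real X = (real j) ^ 19"
            by (simp add: X_def k_def flip: power_mult power_add)
          moreover have "real j ^ 3 * (real k ^ 2 * real k ^ 2) = (real j) ^ 19"
            by (simp add: X_def k_def flip: power_mult power_add)
          ultimately have "(real X)\<^sup>2 * real k / (real k ^ 2 * real k ^ 2) = real j ^ 3 / real X"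
            using k X1 by (subst frac_eq_eq) auto
          moreover have "2 * 4 * ((real X)\<^sup>2 * (2 * real m * real k) / (4 * (real k ^ 2 * real k ^ 2)))
              = 4 * real m * ((real X)\<^sup>2 * real k / (real k ^ 2 * real k ^ 2))"
            by simp
          ultimately show ?thesis by simp
        qed
        finally show "norm (ee ((real x)\<^sup>2 / (4 * real N)) - ee ((real x)\<^sup>2 / (4 * real N')))
            \<le> 4 * real m * real j ^ 3 / real X" .
      qed
      also have "\<dots> = 4 * real m * real j ^ 3" using X1 by simp
      finally show ?thesis .
    qed
    have gN: "gauss_sum 1 N = of_nat k * gauss_sum 1 m"
      unfolding N_def using m k by (intro gauss_sum_mult_square) auto
    have gN': "gauss_sum 1 N' = of_nat k' * G"
      unfolding N'_def G_def using k' by (intro gauss_sum_mult_square) auto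
    have j3: "1 \<le> real j ^ 3" using j by simp
    have m1: "1 \<le> real m" using m by simp
    have mj: "1 \<le> real m * real j ^ 3" using mult_mono[OF m1 j3] by simp
    have a1: "norm (gauss_sum 1 N - 2 * ?H N) \<le> 2 + 4 * (real m * real j ^ 3)"
      using gauss_sum_approx[of X N] X1 NX N'N NX_eq by simp
    have a2: "norm (gauss_sum 1 N' - 2 * ?H N') \<le> 2 + 4 * (real m * real j ^ 3)"
      using gauss_sum_approx[of X N'] X1 NX N'X by simp
    have "norm (gauss_sum 1 N - gauss_sum 1 N')
        = norm ((gauss_sum 1 N - 2 * ?H N) - (gauss_sum 1 N' - 2 * ?H N') + 2 * (?H N - ?H N'))"
      by (simp add: algebra_simps)
    also have "\<dots> \<le> norm ((gauss_sum 1 N - 2 * ?H N) - (gauss_sum 1 N' - 2 * ?H N')) + norm (2 * (?H N - ?H N'))"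
      by (rule norm_triangle_ineq)
    also have "\<dots> \<le> norm (gauss_sum 1 N - 2 * ?H N) + norm (gauss_sum 1 N' - 2 * ?H N') + 2 * norm (?H N - ?H N')"
      by (intro add_mono norm_triangle_ineq4) (simp only: norm_mult norm_numeral order_refl)
    also have "\<dots> \<le> 20 * (real m * real j ^ 3)"
      using a1 a2 head mj by linarith
    finally have d1: "norm (of_nat k * gauss_sum 1 m - of_nat k' * G) \<le> 20 * (real m * real j ^ 3)"
      by (simp add: gN gN')
    have "norm (of_nat k' * G - of_real s * G) = \<bar>real k' - s\<bar> * norm G"
      by (metis left_diff_distrib norm_mult norm_of_real of_real_diff of_real_of_nat_eq)
    also have "\<dots> \<le> 1 * norm G" using k'1 k'2 by (intro mult_right_mono) auto
    also have "\<dots> \<le> real j ^ 3 * norm G" using j3 by (intro mult_right_mono) auto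
    finally have d2: "norm (of_nat k' * G - of_real s * G) \<le> real j ^ 3 * norm G" .
    \<comment> \<open>The error \<open>?d\<close> does not depend on \<open>j\<close>. It occurs
      here with the factor \<open>k = j ^ 4\<close> against a bound of order \<open>j ^ 3\<close>,
      so letting \<open>j\<close> grow forces it to vanish.\<close>
    have "real k * norm ?d = norm (of_nat k * gauss_sum 1 m - of_real s * G)"
    proof -
      have "of_nat k * gauss_sum 1 m - of_real s * G = of_nat k * ?d"
        by (simp add: s_def algebra_simps)
      then show ?thesis by (simp add: norm_mult)
    qed
    also have "\<dots> \<le> norm (of_nat k * gauss_sum 1 m - of_nat k' * G) + norm (of_nat k' * G - of_real s * G)"
      using norm_triangle_ineq[of "of_nat k * gauss_sum 1 m - of_nat k' * G" "of_nat k' * G - of_real s * G"]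
      by simp
    also have "\<dots> \<le> C * real j ^ 3"
      using d1 d2 by (simp add: C_def algebra_simps)
    finally have "real j ^ 4 * norm ?d \<le> C * real j ^ 3" by (simp add: k_def)
    moreover have "real j ^ 4 = real j * real j ^ 3" by (simp add: power_eq_if)
    ultimately have "real j ^ 3 * (real j * norm ?d) \<le> real j ^ 3 * C" by (simp add: mult_ac)
    then have "real j * norm ?d \<le> C" using j by (subst (asm) mult_le_cancel_left_pos) auto
    then show ?thesis using j by (simp add: field_simps)
  qed
  have "?d = 0"
  proof (rule ccontr)
    assume "?d \<noteq> 0"
    then have pos: "norm ?d > 0" by simp
    obtain j where j: "real j > C / norm ?d" using reals_Archimedean2 by blast
    have "norm ?d \<le> C / real (max 2 j)" by (rule bound) simp
    then have "norm ?d * real (max 2 j) \<le> C" by (simp add: field_simps)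
    moreover have "C < norm ?d * real j" using j pos by (simp add: field_simps)
    moreover have "norm ?d * real j \<le> norm ?d * real (max 2 j)" by (intro mult_left_mono) auto
    ultimately show False by linarith
  qed
  moreover have "G = 1 + \<i>" by (simp add: G_def gauss_sum_1[of 1, simplified] ee_quarter)
  ultimately show ?thesis by simp
qed

section \<open>Milgram's formula\<close>

lemma int_add_mod_eq_self:
  fixes p j n :: int
  assumes "(p + j) mod n = j" "0 \<le> p" "p < n" "0 \<le> j" "j < n"
  shows "p = 0"
proof -
  have "(p + j) mod n = j mod n" using assms by simp
  then have "n dvd p" by (simp add: mod_eq_dvd_iff)
  then show ?thesis using assms zdvd_imp_le[of n p] by linarith
qed

section \<open>Positive definite even lattices and orthogonalisation inside them\<close>

locale pos_even_lattice =
  fixes L :: "'v::real_vector set" and B :: "'v \<Rightarrow> 'v \<Rightarrow> real" and S :: "'v set"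
  assumes bil: "bilinear B" and sym: "B x y = B y x" and basis: "int_basis S L"
    and even: "even_form L B" and pos: "pos_def_form L B"
begin

lemmas B_add_left = bilinear_ladd[OF bil] and B_add_right = bilinear_radd[OF bil]
  and B_diff_left = bilinear_lsub[OF bil]

lemma B_scale_left: "B (c *\<^sub>R x) y = c * B x y"
  using bilinear_lmul[OF bil] by simp

lemma B_scale_right: "B x (c *\<^sub>R y) = c * B x y"
  using bilinear_rmul[OF bil] by simp

lemma B_sum_left: "B (\<Sum>i\<in>I. f i) y = (\<Sum>i\<in>I. B (f i) y)"
  using bil linear_sum[of "\<lambda>x. B x y" f I] by (auto simp: bilinear_def)

lemma B_sum_right: "B x (\<Sum>i\<in>I. f i) = (\<Sum>i\<in>I. B x (f i))"
  using bil linear_sum[of "B x" f I] by (auto simp: bilinear_def)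

lemma S: "finite S" "independent S"
  using basis by (auto simp: int_basis_def)

lemma L_iff: "x \<in> L \<longleftrightarrow> (\<exists>c :: 'v \<Rightarrow> int. x = (\<Sum>s\<in>S. of_int (c s) *\<^sub>R s))"
  using basis by (auto simp: int_basis_def)

lemma L_zero: "0 \<in> L"
  unfolding L_iff by (rule exI[of _ "\<lambda>_. 0"]) simp

lemma L_add: "x + y \<in> L" if "x \<in> L" "y \<in> L"
proof -
  from that obtain c d :: "'v \<Rightarrow> int"
    where "x = (\<Sum>s\<in>S. of_int (c s) *\<^sub>R s)" "y = (\<Sum>s\<in>S. of_int (d s) *\<^sub>R s)"
    unfolding L_iff by blast
  then have "x + y = (\<Sum>s\<in>S. of_int (c s + d s) *\<^sub>R s)"
    by (simp add: scaleR_add_left sum.distrib)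
  then show ?thesis unfolding L_iff by (rule exI[of _ "\<lambda>s. c s + d s"])
qed

lemma L_scale: "of_int k *\<^sub>R x \<in> L" if "x \<in> L"
proof -
  from that obtain c :: "'v \<Rightarrow> int" where "x = (\<Sum>s\<in>S. of_int (c s) *\<^sub>R s)"
    unfolding L_iff by blast
  then have "of_int k *\<^sub>R x = (\<Sum>s\<in>S. of_int (k * c s) *\<^sub>R s)"
    by (simp add: scaleR_sum_right)
  then show ?thesis unfolding L_iff by (rule exI[of _ "\<lambda>s. k * c s"])
qed

lemma L_uminus: "x \<in> L \<Longrightarrow> - x \<in> L"
  using L_scale[of x "-1"] by simp

lemma L_diff: "x \<in> L \<Longrightarrow> y \<in> L \<Longrightarrow> x - y \<in> L"
  using L_add[of x "- y"] L_uminus by simp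

lemma L_sum: "(\<And>i. i \<in> I \<Longrightarrow> f i \<in> L) \<Longrightarrow> (\<Sum>i\<in>I. f i) \<in> L"
  by (induction I rule: infinite_finite_induct) (auto intro: L_zero L_add)

lemma S_subset: "S \<subseteq> L"
proof
  fix t assume t: "t \<in> S"
  have "(\<Sum>s\<in>S. of_int (if s = t then 1 else 0) *\<^sub>R s) = (\<Sum>s\<in>S. if s = t then s else 0)"
    by (rule sum.cong) auto
  also have "\<dots> = t" using S t by simp
  finally show "t \<in> L" unfolding L_iff
    by (intro exI[of _ "\<lambda>s. if s = t then 1 else 0"]) simp
qed

lemma span_S: "span S = span L"
  using S_subset span_superset[of L]
  by (auto simp: span_eq L_iff intro!: span_sum span_scale intro: span_base)

lemma B_Ints: "x \<in> L \<Longrightarrow> y \<in> L \<Longrightarrow> B x y \<in> \<int>"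
  using even by (auto simp: even_form_def)

lemma B_half_Ints: "x \<in> L \<Longrightarrow> B x x / 2 \<in> \<int>"
  using even by (auto simp: even_form_def)

lemma B_pos: "x \<in> L \<Longrightarrow> x \<noteq> 0 \<Longrightarrow> B x x > 0"
  using pos by (auto simp: pos_def_form_def)

lemma L_subset_dual: "L \<subseteq> dual_lattice L B"
  by (auto simp: dual_lattice_def B_Ints span_base)

lemma dual_add: "x \<in> dual_lattice L B \<Longrightarrow> y \<in> dual_lattice L B \<Longrightarrow> x + y \<in> dual_lattice L B"
  by (auto simp: dual_lattice_def B_add_left span_add)

lemma dual_diff: "x \<in> dual_lattice L B \<Longrightarrow> y \<in> dual_lattice L B \<Longrightarrow> x - y \<in> dual_lattice L B"
  by (auto simp: dual_lattice_def B_diff_left span_diff)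

lemma dual_scale: "x \<in> dual_lattice L B \<Longrightarrow> of_int k *\<^sub>R x \<in> dual_lattice L B"
  by (auto simp: dual_lattice_def B_scale_left span_scale)

text \<open>Gram-Schmidt without leaving \<open>L\<close>: the new vector is first multiplied by an
  integer that makes its projection integral. Positive definiteness keeps the divisors
  \<open>B b b\<close> nonzero.\<close>

lemma orthogonal_subset_exists:
  assumes "finite T" "T \<subseteq> L" "independent T"
  shows "\<exists>F. finite F \<and> F \<subseteq> L \<and> 0 \<notin> F \<and> (\<forall>b\<in>F. \<forall>c\<in>F. b \<noteq> c \<longrightarrow> B b c = 0) \<and>
     span F = span T \<and> card F = card T"
  using assms
proof (induction T rule: finite_induct)
  case empty
  then show ?case by (intro exI[of _ "{}"]) simp
next
  case (insert s T)
  then have "independent T" and sT: "s \<notin> span T" by (simp_all add: independent_insert)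
  with insert.IH insert.prems(1) obtain F where F: "finite F" "F \<subseteq> L" "0 \<notin> F"
      "\<forall>b\<in>F. \<forall>c\<in>F. b \<noteq> c \<longrightarrow> B b c = 0" "span F = span T" "card F = card T"
    by blast
  \<comment> \<open>\<open>D\<close> clears denominators: it is a multiple of \<open>B b b\<close>
    for every \<open>b\<close> in \<open>F\<close>, so the projection of \<open>D\<close> times
    \<open>s\<close> has integral coefficients.\<close>
  define D where "D = (\<Prod>b\<in>F. B b b)"
  have Bpos: "B b b > 0" if "b \<in> F" for b using F that by (intro B_pos) auto
  have D: "D > 0" unfolding D_def by (rule prod_pos) (use Bpos in auto)
  define p where "p = (\<Sum>b\<in>F. (D * B s b / B b b) *\<^sub>R b)"
  define b' where "b' = D *\<^sub>R s - p"
  have pF: "p \<in> span F" unfolding p_def by (intro span_sum span_scale span_base)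
  have Dint: "D \<in> \<int>" unfolding D_def using F by (intro Ints_prod) (auto intro: B_Ints)
  have coeff: "D * B s b / B b b \<in> \<int>" if b: "b \<in> F" for b
  proof -
    have "D = B b b * (\<Prod>c\<in>F - {b}. B c c)"
      unfolding D_def using F(1) b by (rule prod.remove)
    then have "D * B s b / B b b = (\<Prod>c\<in>F - {b}. B c c) * B s b"
      using Bpos[OF b] by simp
    also have "\<dots> \<in> \<int>" using F b insert.prems
      by (intro Ints_mult Ints_prod B_Ints) auto
    finally show ?thesis .
  qed
  have b'L: "b' \<in> L"
  proof -
    have "D *\<^sub>R s \<in> L" using Dint insert.prems by (auto elim!: Ints_cases intro!: L_scale)
    moreover have "p \<in> L" unfolding p_def
    proof (rule L_sum)
      fix b assume "b \<in> F"
      then show "(D * B s b / B b b) *\<^sub>R b \<in> L"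
        using coeff[of b] F by (auto elim!: Ints_cases intro!: L_scale)
    qed
    ultimately show ?thesis unfolding b'_def by (rule L_diff)
  qed
  have orth: "B b' c = 0" if c: "c \<in> F" for c
  proof -
    have "B p c = (\<Sum>b\<in>F. if b = c then D * B s c else 0)"
      unfolding p_def B_sum_left B_scale_left
    proof (rule sum.cong[OF refl])
      fix b assume b: "b \<in> F"
      show "D * B s b / B b b * B b c = (if b = c then D * B s c else 0)"
      proof (cases "b = c")
        case True
        then show ?thesis using Bpos[OF c] by simp
      next
        case False
        then have "B b c = 0" using F(4) b c by blast
        then show ?thesis using False by simp
      qed
    qed
    also have "\<dots> = D * B s c" using F(1) c by simp
    finally show ?thesis by (simp add: b'_def B_diff_left B_scale_left)
  qed
  \<comment> \<open>The factor \<open>D\<close> may shrink the lattice, but it does not affect real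
    spans.\<close>
  have scale: "x \<in> span A" if "D *\<^sub>R x \<in> span A" for x A
    using span_scale[OF that, of "1 / D"] D by simp
  have b'0: "b' \<noteq> 0"
  proof
    assume "b' = 0"
    then have "D *\<^sub>R s \<in> span F" using pF by (simp add: b'_def)
    then have "s \<in> span F" by (rule scale)
    then show False using sT F(5) by simp
  qed
  have b'F: "b' \<notin> F" using orth[of b'] B_pos[OF b'L b'0] by auto
  have "span (insert b' F) = span (insert s T)"
  proof -
    have "span (insert b' F) = span (insert s F)"
    proof (unfold span_eq, intro conjI)
      show "insert b' F \<subseteq> span (insert s F)"
        using pF span_mono[of F "insert s F"] unfolding b'_def
        by (auto intro!: span_diff span_scale intro: span_base)
      have "D *\<^sub>R s = b' + p" by (simp add: b'_def)
      moreover have "b' + p \<in> span (insert b' F)"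
        using pF span_mono[of F "insert b' F"] by (auto intro!: span_add intro: span_base)
      ultimately have "s \<in> span (insert b' F)" by (metis scale)
      then show "insert s F \<subseteq> span (insert b' F)" by (auto intro: span_base)
    qed
    also have "\<dots> = span (insert s T)" unfolding span_insert F(5) ..
    finally show ?thesis .
  qed
  moreover have "\<forall>b\<in>insert b' F. \<forall>c\<in>insert b' F. b \<noteq> c \<longrightarrow> B b c = 0"
    using F(4) orth sym[of _ b'] by (metis insert_iff)
  ultimately show ?case using F(1,2,3,6) b'F b'0 b'L insert.hyps
    by (intro exI[of _ "insert b' F"]) simp
qed

end

section \<open>An orthogonal sublattice \<open>M\<close> of full rank, and its dual modulo
  \<open>M\<close>\<close>

locale orthogonal_frame = pos_even_lattice L B S for L :: "'v::real_vector set" and B S +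
  fixes F :: "'v set"
  assumes fin: "finite F" and F_subset: "F \<subseteq> L" and zero_notin: "0 \<notin> F"
    and orth: "\<forall>b\<in>F. \<forall>c\<in>F. b \<noteq> c \<longrightarrow> B b c = 0" and span_F: "span F = span L"
begin

text \<open>
  With \<open>M\<close> the sublattice spanned by \<open>F\<close>, the elements of the dual of \<open>M\<close> are the vectors
  \<open>frame_vec c\<close>, and \<open>frame_box\<close> represents the dual modulo \<open>M\<close>.
\<close>

definition frame_norm :: "'v \<Rightarrow> nat" where
  "frame_norm b = nat \<lfloor>B b b\<rfloor>"

definition frame_vec :: "('v \<Rightarrow> int) \<Rightarrow> 'v" where
  "frame_vec c = (\<Sum>b\<in>F. (of_int (c b) / B b b) *\<^sub>R b)"

definition frame_lattice :: "'v set" where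
  "frame_lattice = {\<Sum>b\<in>F. of_int (k b) *\<^sub>R b | k :: 'v \<Rightarrow> int. True}"

definition frame_dual :: "'v set" where
  "frame_dual = {x \<in> span L. \<forall>b\<in>F. B x b \<in> \<int>}"

definition frame_box :: "('v \<Rightarrow> int) set" where
  "frame_box = PiE F (\<lambda>b. {0..<int (frame_norm b)})"

text \<open>For \<open>x\<close> in \<open>frame_dual\<close> the pairings \<open>B x b\<close> are
  integers that determine \<open>x\<close>, and their residues label its class modulo
  \<open>M\<close>. The floor only turns these reals into integers of type
  \<open>int\<close>.\<close>

definition frame_reduce :: "'v \<Rightarrow> 'v \<Rightarrow> int" where
  "frame_reduce x = (\<lambda>b\<in>F. \<lfloor>B x b\<rfloor> mod int (frame_norm b))"

lemma frame_norm_pos: "b \<in> F \<Longrightarrow> B b b > 0"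
  using B_pos F_subset zero_notin by blast

lemma real_frame_norm: "b \<in> F \<Longrightarrow> real (frame_norm b) = B b b"
  using B_Ints[of b b] F_subset frame_norm_pos[of b]
  by (auto simp: frame_norm_def elim!: Ints_cases)

lemma frame_norm_even:
  assumes "b \<in> F"
  shows "even (frame_norm b)" "frame_norm b div 2 > 0" "B b b = 2 * real (frame_norm b div 2)"
proof -
  obtain k :: int where k: "B b b / 2 = of_int k"
    using B_half_Ints[of b] F_subset assms by (metis Ints_cases subsetD)
  then have Bk: "B b b = of_int (2 * k)" by simp
  then have n: "frame_norm b = nat (2 * k)" unfolding frame_norm_def by (simp only: floor_of_int)
  have "k > 0" using frame_norm_pos[OF assms] Bk by simp
  then have n': "frame_norm b = 2 * nat k" using n by (simp add: nat_mult_distrib)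
  then show "even (frame_norm b)" by simp
  show "frame_norm b div 2 > 0" using n' \<open>k > 0\<close> by simp
  show "B b b = 2 * real (frame_norm b div 2)" using n' real_frame_norm[OF assms] by simp
qed

lemma B_combination: "c \<in> F \<Longrightarrow> B (\<Sum>b\<in>F. u b *\<^sub>R b) c = u c * B c c"
proof -
  assume c: "c \<in> F"
  have "B (\<Sum>b\<in>F. u b *\<^sub>R b) c = (\<Sum>b\<in>F. if b = c then u c * B c c else 0)"
    unfolding B_sum_left B_scale_left
  proof (rule sum.cong[OF refl])
    fix b assume "b \<in> F"
    then show "u b * B b c = (if b = c then u c * B c c else 0)"
      using orth c by (cases "b = c") auto
  qed
  then show ?thesis using fin c by simp
qed

lemma B_frame_vec: "b \<in> F \<Longrightarrow> B (frame_vec c) b = of_int (c b)"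
  using B_combination[of b "\<lambda>b. of_int (c b) / B b b"] frame_norm_pos[of b]
  by (simp add: frame_vec_def)

lemma span_expansion: "x \<in> span L \<Longrightarrow> x = (\<Sum>b\<in>F. (B x b / B b b) *\<^sub>R b)"
proof -
  assume "x \<in> span L"
  then obtain u where x: "x = (\<Sum>b\<in>F. u b *\<^sub>R b)"
    using span_F fin by (auto simp: span_finite)
  have "u b = B x b / B b b" if "b \<in> F" for b
    using B_combination[OF that, of u] frame_norm_pos[OF that] by (simp add: x)
  then show ?thesis by (subst (1) x) (auto intro!: sum.cong)
qed

lemma frame_vec_dual: "frame_vec c \<in> frame_dual"
proof -
  have "frame_vec c \<in> span F" unfolding frame_vec_def by (intro span_sum span_scale span_base)
  then show ?thesis by (auto simp: frame_dual_def span_F B_frame_vec)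
qed

lemma dual_subset_frame_dual: "dual_lattice L B \<subseteq> frame_dual"
  using F_subset by (auto simp: frame_dual_def dual_lattice_def)

lemma L_subset_frame_dual: "L \<subseteq> frame_dual"
  using L_subset_dual dual_subset_frame_dual by blast

lemma frame_dual_add: "x \<in> frame_dual \<Longrightarrow> y \<in> frame_dual \<Longrightarrow> x + y \<in> frame_dual"
  by (auto simp: frame_dual_def B_add_left span_add)

lemma frame_dual_uminus: "x \<in> frame_dual \<Longrightarrow> - x \<in> frame_dual"
  by (auto simp: frame_dual_def bilinear_lneg[OF bil] span_neg)

lemma frame_lattice_subset: "frame_lattice \<subseteq> L"
  using F_subset by (auto simp: frame_lattice_def intro!: L_sum L_scale)

lemma B_frame_lattice: "x \<in> frame_dual \<Longrightarrow> y \<in> frame_lattice \<Longrightarrow> B x y \<in> \<int>"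
  by (auto simp: frame_lattice_def frame_dual_def B_sum_right B_scale_right intro!: Ints_sum Ints_mult)

lemma frame_lattice_uminus: "y \<in> frame_lattice \<Longrightarrow> - y \<in> frame_lattice"
proof -
  assume "y \<in> frame_lattice"
  then obtain k :: "'v \<Rightarrow> int" where "y = (\<Sum>b\<in>F. of_int (k b) *\<^sub>R b)" by (auto simp: frame_lattice_def)
  then have "- y = (\<Sum>b\<in>F. of_int (- k b) *\<^sub>R b)" by (simp add: sum_negf)
  then show ?thesis unfolding frame_lattice_def mem_Collect_eq by (intro exI[of _ "\<lambda>b. - k b"]) simp
qed

lemma frame_reduce_box: "frame_reduce x \<in> frame_box"
proof -
  have "int (frame_norm b) > 0" if "b \<in> F" for b
    using frame_norm_pos[OF that] real_frame_norm[OF that] by simp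
  then show ?thesis by (auto simp: frame_box_def frame_reduce_def)
qed

lemma finite_frame_box: "finite frame_box"
  unfolding frame_box_def using fin by (intro finite_PiE) auto

lemma frame_reduce_vec: "c \<in> frame_box \<Longrightarrow> frame_reduce (frame_vec c) = c"
  by (auto simp: frame_reduce_def frame_box_def B_frame_vec fun_eq_iff PiE_iff extensional_def)

lemma frame_reduce_add: 
  assumes "x \<in> frame_dual" "y \<in> frame_lattice"
  shows "frame_reduce (x + y) = frame_reduce x"
proof -
  obtain k :: "'v \<Rightarrow> int" where y: "y = (\<Sum>b\<in>F. of_int (k b) *\<^sub>R b)"
    using assms by (auto simp: frame_lattice_def)
  have "\<lfloor>B (x + y) b\<rfloor> mod int (frame_norm b) = \<lfloor>B x b\<rfloor> mod int (frame_norm b)" if b: "b \<in> F" for b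
  proof -
    obtain z where z: "B x b = of_int z" using assms b by (auto simp: frame_dual_def elim!: Ints_cases)
    have "B (x + y) b = of_int (z + k b * int (frame_norm b))"
      unfolding B_add_left y B_combination[OF b] real_frame_norm[OF b, symmetric] z by simp
    then have "\<lfloor>B (x + y) b\<rfloor> = z + k b * int (frame_norm b)" by (simp only: floor_of_int)
    then show ?thesis by (simp add: z)
  qed
  then show ?thesis by (auto simp: frame_reduce_def fun_eq_iff)
qed

text \<open>Division with remainder in every coordinate: by orthogonality \<open>x\<close> has
  coordinates \<open>B x b / B b b\<close>, and \<open>frame_reduce\<close> keeps the remainder of
  \<open>B x b\<close>.\<close>

lemma frame_reduce_diff:
  assumes "x \<in> frame_dual"
  shows "x - frame_vec (frame_reduce x) \<in> frame_lattice"
proof -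
  have "x - frame_vec (frame_reduce x) = (\<Sum>b\<in>F. (B x b / B b b) *\<^sub>R b) - frame_vec (frame_reduce x)"
    using assms span_expansion by (simp add: frame_dual_def)
  also have "\<dots> = (\<Sum>b\<in>F. (B x b / B b b - of_int (frame_reduce x b) / B b b) *\<^sub>R b)"
    by (simp add: frame_vec_def scaleR_diff_left sum_subtractf)
  also have "\<dots> = (\<Sum>b\<in>F. of_int (\<lfloor>B x b\<rfloor> div int (frame_norm b)) *\<^sub>R b)"
  proof (rule sum.cong[OF refl])
    fix b assume b: "b \<in> F"
    obtain z where z: "B x b = of_int z" using assms b by (auto simp: frame_dual_def elim!: Ints_cases)
    have "z = z div int (frame_norm b) * int (frame_norm b) + z mod int (frame_norm b)" by simp
    then have "(of_int z :: real) = of_int (z div int (frame_norm b)) * B b b + of_int (z mod int (frame_norm b))"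
      unfolding real_frame_norm[OF b, symmetric] by (metis of_int_add of_int_mult of_int_of_nat_eq)
    then have "(of_int z - of_int (z mod int (frame_norm b))) / B b b = of_int (z div int (frame_norm b))"
      using frame_norm_pos[OF b] by simp
    then have "B x b / B b b - of_int (frame_reduce x b) / B b b = of_int (\<lfloor>B x b\<rfloor> div int (frame_norm b))"
      using b by (simp add: frame_reduce_def z diff_divide_distrib)
    then show "(B x b / B b b - of_int (frame_reduce x b) / B b b) *\<^sub>R b
        = of_int (\<lfloor>B x b\<rfloor> div int (frame_norm b)) *\<^sub>R b" by simp
  qed
  finally show ?thesis unfolding frame_lattice_def mem_Collect_eq
    by (intro exI[of _ "\<lambda>b. \<lfloor>B x b\<rfloor> div int (frame_norm b)"]) simp
qed

lemma frame_vec_reduce: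
  assumes "x \<in> frame_dual"
  obtains y where "y \<in> frame_lattice" "frame_vec (frame_reduce x) = x + y"
  using frame_lattice_uminus[OF frame_reduce_diff[OF assms]] by (metis add_diff_cancel_left' minus_diff_eq add_diff_eq)

text \<open>The box is not closed under addition, so translation by \<open>t\<close> is followed by
  reduction modulo \<open>M\<close>; invariance of \<open>U\<close> and \<open>U'\<close> under
  \<open>M\<close> lets membership survive the reduction. The inverse is translation by
  \<open>- t\<close>. It is applied with both sets equal to \<open>L\<close>, with both equal to
  \<open>UNIV\<close>, and with \<open>L\<close> and a coset of \<open>L\<close> in its
  dual.\<close>

lemma frame_shift_bij:
  assumes t: "t \<in> frame_dual"
    and U: "\<And>x y. x \<in> frame_dual \<Longrightarrow> y \<in> frame_lattice \<Longrightarrow> x \<in> U \<Longrightarrow> x + y \<in> U"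
    and U': "\<And>x y. x \<in> frame_dual \<Longrightarrow> y \<in> frame_lattice \<Longrightarrow> x \<in> U' \<Longrightarrow> x + y \<in> U'"
    and UU': "\<And>x. x \<in> frame_dual \<Longrightarrow> x \<in> U \<Longrightarrow> x + t \<in> U'" "\<And>x. x \<in> frame_dual \<Longrightarrow> x \<in> U' \<Longrightarrow> x - t \<in> U"
  shows "bij_betw (\<lambda>c. frame_reduce (frame_vec c + t))
     {c \<in> frame_box. frame_vec c \<in> U} {c \<in> frame_box. frame_vec c \<in> U'}"
proof -
  have inv: "frame_reduce (frame_vec (frame_reduce (frame_vec c + s)) - s) = c"
    if "s \<in> frame_dual" "c \<in> frame_box" for c s
  proof -
    have "frame_vec c + s \<in> frame_dual" using that frame_vec_dual frame_dual_add by blast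
    then obtain y where y: "y \<in> frame_lattice" "frame_vec (frame_reduce (frame_vec c + s)) = frame_vec c + s + y"
      by (rule frame_vec_reduce)
    then show ?thesis using frame_reduce_add[OF frame_vec_dual y(1)] frame_reduce_vec[OF that(2)] by simp
  qed
  have mt: "- t \<in> frame_dual" using t by (rule frame_dual_uminus)
  show ?thesis
  proof (rule bij_betw_byWitness[of _ "\<lambda>c. frame_reduce (frame_vec c - t)"])
    show "\<forall>c\<in>{c \<in> frame_box. frame_vec c \<in> U}. frame_reduce (frame_vec (frame_reduce (frame_vec c + t)) - t) = c"
      using inv[OF t] by simp
    show "\<forall>c\<in>{c \<in> frame_box. frame_vec c \<in> U'}. frame_reduce (frame_vec (frame_reduce (frame_vec c - t)) + t) = c"
      using inv[OF mt] by simp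
    have "frame_vec (frame_reduce (frame_vec c + t)) \<in> U'" if "frame_vec c \<in> U" for c
    proof -
      have d: "frame_vec c + t \<in> frame_dual" using t frame_vec_dual frame_dual_add by blast
      then obtain y where "y \<in> frame_lattice" "frame_vec (frame_reduce (frame_vec c + t)) = frame_vec c + t + y"
        by (rule frame_vec_reduce)
      then show ?thesis using U'[OF d] UU'(1)[OF frame_vec_dual that] by simp
    qed
    then show "(\<lambda>c. frame_reduce (frame_vec c + t)) ` {c \<in> frame_box. frame_vec c \<in> U} \<subseteq> {c \<in> frame_box. frame_vec c \<in> U'}"
      using frame_reduce_box by auto
    have "frame_vec (frame_reduce (frame_vec c - t)) \<in> U" if "frame_vec c \<in> U'" for c
    proof -
      have d: "frame_vec c - t \<in> frame_dual" using mt frame_vec_dual[of c] frame_dual_add[of "frame_vec c" "- t"] by simp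
      then obtain y where "y \<in> frame_lattice" "frame_vec (frame_reduce (frame_vec c - t)) = frame_vec c - t + y"
        by (rule frame_vec_reduce)
      then show ?thesis using U[OF d] UU'(2)[OF frame_vec_dual that] by simp
    qed
    then show "(\<lambda>c. frame_reduce (frame_vec c - t)) ` {c \<in> frame_box. frame_vec c \<in> U'} \<subseteq> {c \<in> frame_box. frame_vec c \<in> U}"
      using frame_reduce_box by auto
  qed
qed

section \<open>The Gauss sum over the dual of \<open>M\<close>, evaluated in two ways\<close>

definition frame_q :: "'v \<Rightarrow> complex" where
  "frame_q x = ee (B x x / 2)"

lemma frame_q_add: "frame_q (x + y) = frame_q x * frame_q y * ee (B x y)"
proof -
  have "B (x + y) (x + y) / 2 = B x x / 2 + B y y / 2 + B x y"
    using sym[of y x] by (simp add: B_add_left B_add_right field_simps)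
  then show ?thesis unfolding frame_q_def by (simp only: ee_add)
qed

lemma frame_q_L: "x \<in> L \<Longrightarrow> frame_q x = 1"
  using B_half_Ints[of x] by (simp add: frame_q_def ee_eq_1_iff)

lemma ee_B_reduce:
  assumes "x \<in> frame_dual" "z \<in> frame_dual"
  shows "ee (B z (frame_vec (frame_reduce x))) = ee (B z x)"
proof -
  obtain y where y: "y \<in> frame_lattice" "frame_vec (frame_reduce x) = x + y"
    using frame_vec_reduce assms by blast
  then show ?thesis using B_frame_lattice[OF assms(2) y(1)] by (simp add: B_add_right ee_add_Ints)
qed

lemma frame_q_reduce:
  assumes "x \<in> frame_dual"
  shows "frame_q (frame_vec (frame_reduce x)) = frame_q x"
proof -
  obtain y where y: "y \<in> frame_lattice" "frame_vec (frame_reduce x) = x + y"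
    using frame_vec_reduce assms by blast
  then have "frame_q y = 1" "ee (B x y) = 1"
    using frame_q_L frame_lattice_subset B_frame_lattice assms by (auto simp: ee_eq_1_iff)
  then show ?thesis by (simp add: y frame_q_add)
qed

lemma L_add_frame_lattice: "x \<in> L \<Longrightarrow> y \<in> frame_lattice \<Longrightarrow> x + y \<in> L"
  using frame_lattice_subset L_add by blast

text \<open>Pairing with \<open>x\<close> is a character of \<open>L\<close> modulo
  \<open>M\<close>, trivial just when \<open>x\<close> is in the dual of \<open>L\<close>. Otherwise
  it has a value other than 1 at some \<open>w\<close>, and translating by \<open>w\<close>
  multiplies the sum by that value.\<close>

lemma character_sum_L:
  assumes x: "x \<in> frame_dual"
  shows "(\<Sum>l\<in>{c \<in> frame_box. frame_vec c \<in> L}. ee (B x (frame_vec l)))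
    = (if x \<in> dual_lattice L B then of_nat (card {c \<in> frame_box. frame_vec c \<in> L}) else 0)"
proof (cases "x \<in> dual_lattice L B")
  case True
  then have "ee (B x (frame_vec l)) = 1" if "frame_vec l \<in> L" for l
    using that by (auto simp: ee_eq_1_iff dual_lattice_def)
  then show ?thesis using True by simp
next
  case False
  let ?BL = "{c \<in> frame_box. frame_vec c \<in> L}"
  let ?s = "\<Sum>l\<in>?BL. ee (B x (frame_vec l))"
  obtain w where w: "w \<in> L" "B x w \<notin> \<int>"
    using False x by (auto simp: frame_dual_def dual_lattice_def)
  then have wd: "w \<in> frame_dual" using L_subset_frame_dual by blast
  have bij: "bij_betw (\<lambda>c. frame_reduce (frame_vec c + w)) ?BL ?BL"
    using w L_add L_diff L_add_frame_lattice by (intro frame_shift_bij wd) auto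
  have "?s = (\<Sum>l\<in>?BL. ee (B x (frame_vec (frame_reduce (frame_vec l + w)))))"
    using sum.reindex_bij_betw[OF bij, of "\<lambda>l. ee (B x (frame_vec l))"] by simp
  also have "\<dots> = (\<Sum>l\<in>?BL. ee (B x (frame_vec l)) * ee (B x w))"
    by (intro sum.cong refl)
      (simp add: ee_B_reduce[OF frame_dual_add[OF frame_vec_dual wd] x] B_add_right ee_add)
  also have "\<dots> = ?s * ee (B x w)" by (simp add: sum_distrib_right)
  finally have "?s * (ee (B x w) - 1) = 0" by (simp add: algebra_simps)
  then show ?thesis using False w(2) by (simp add: ee_eq_1_iff)
qed

lemma card_box_L_pos: "card {c \<in> frame_box. frame_vec c \<in> L} > 0"
proof -
  have "0 \<in> frame_dual" using L_zero L_subset_frame_dual by blast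
  then obtain y where "y \<in> frame_lattice" "frame_vec (frame_reduce 0) = 0 + y" by (rule frame_vec_reduce)
  then have "frame_reduce 0 \<in> {c \<in> frame_box. frame_vec c \<in> L}"
    using frame_reduce_box frame_lattice_subset by auto
  then show ?thesis using finite_frame_box by (auto simp: card_gt_0_iff)
qed

text \<open>Translating the box by \<open>l\<close> in \<open>L\<close> preserves the sum and, since
  \<open>frame_q\<close> is 1 on \<open>L\<close>, multiplies the term at \<open>c\<close> by a
  character value. Averaging over all \<open>l\<close> retains just those \<open>c\<close> that give
  vectors in the dual of \<open>L\<close>.\<close>

lemma box_sum_dual:
  "(\<Sum>c\<in>frame_box. frame_q (frame_vec c))
    = (\<Sum>c\<in>{c \<in> frame_box. frame_vec c \<in> dual_lattice L B}. frame_q (frame_vec c))"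
proof -
  let ?BL = "{c \<in> frame_box. frame_vec c \<in> L}"
  have shift: "(\<Sum>c\<in>frame_box. frame_q (frame_vec c))
      = (\<Sum>c\<in>frame_box. frame_q (frame_vec c) * ee (B (frame_vec c) (frame_vec l)))"
    if l: "l \<in> ?BL" for l
  proof -
    have bij: "bij_betw (\<lambda>c. frame_reduce (frame_vec c + frame_vec l)) frame_box frame_box"
      using frame_shift_bij[OF frame_vec_dual[of l], of UNIV UNIV] by simp
    have "(\<Sum>c\<in>frame_box. frame_q (frame_vec c))
        = (\<Sum>c\<in>frame_box. frame_q (frame_vec (frame_reduce (frame_vec c + frame_vec l))))"
      using sum.reindex_bij_betw[OF bij, of "\<lambda>c. frame_q (frame_vec c)"] by simp
    also have "\<dots> = (\<Sum>c\<in>frame_box. frame_q (frame_vec c + frame_vec l))"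
      by (intro sum.cong refl frame_q_reduce frame_dual_add frame_vec_dual)
    also have "\<dots> = (\<Sum>c\<in>frame_box. frame_q (frame_vec c) * ee (B (frame_vec c) (frame_vec l)))"
      using l by (simp add: frame_q_add frame_q_L)
    finally show ?thesis .
  qed
  have "of_nat (card ?BL) * (\<Sum>c\<in>frame_box. frame_q (frame_vec c))
      = (\<Sum>l\<in>?BL. \<Sum>c\<in>frame_box. frame_q (frame_vec c))" by simp
  also have "\<dots> = (\<Sum>l\<in>?BL. \<Sum>c\<in>frame_box. frame_q (frame_vec c) * ee (B (frame_vec c) (frame_vec l)))"
    by (intro sum.cong[OF refl] shift)
  also have "\<dots> = (\<Sum>c\<in>frame_box. \<Sum>l\<in>?BL. frame_q (frame_vec c) * ee (B (frame_vec c) (frame_vec l)))"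
    by (rule sum.swap)
  also have "\<dots> = (\<Sum>c\<in>frame_box. if frame_vec c \<in> dual_lattice L B then of_nat (card ?BL) * frame_q (frame_vec c) else 0)"
    by (intro sum.cong[OF refl]) (simp add: character_sum_L[OF frame_vec_dual] flip: sum_distrib_left)
  also have "\<dots> = of_nat (card ?BL) * (\<Sum>c\<in>{c \<in> frame_box. frame_vec c \<in> dual_lattice L B}. frame_q (frame_vec c))"
    unfolding sum_distrib_left by (rule sum.inter_filter[OF finite_frame_box, symmetric])
  finally show ?thesis using card_box_L_pos by simp
qed

lemma frame_q_vec: "frame_q (frame_vec c) = (\<Prod>b\<in>F. ee ((of_int (c b))\<^sup>2 / (2 * B b b)))"
proof -
  have "B (frame_vec c) (frame_vec c) = (\<Sum>b\<in>F. (of_int (c b))\<^sup>2 / B b b)"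
    by (subst (2) frame_vec_def)
      (simp add: B_sum_right B_scale_right B_frame_vec power2_eq_square)
  then have "B (frame_vec c) (frame_vec c) / 2 = (\<Sum>b\<in>F. (of_int (c b))\<^sup>2 / (2 * B b b))"
    by (simp add: sum_divide_distrib mult.commute)
  then show ?thesis by (simp add: frame_q_def ee_prod[OF fin])
qed

text \<open>The box is a product and the frame is orthogonal, so the sum factors. Because
  \<open>L\<close> is even, \<open>frame_norm b\<close> is twice an integer, and each factor is a
  \<open>gauss_sum\<close> with coefficient 1.\<close>

lemma box_sum_gauss:
  "(\<Sum>c\<in>frame_box. frame_q (frame_vec c)) = (\<Prod>b\<in>F. gauss_sum 1 (frame_norm b div 2))"
proof -
  have "(\<Sum>c\<in>frame_box. frame_q (frame_vec c))
      = (\<Prod>b\<in>F. \<Sum>k\<in>{0..<int (frame_norm b)}. ee ((of_int k)\<^sup>2 / (2 * B b b)))"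
    unfolding frame_box_def frame_q_vec by (subst prod_sum_PiE[OF fin]) auto
  also have "\<dots> = (\<Prod>b\<in>F. gauss_sum 1 (frame_norm b div 2))"
  proof (rule prod.cong[OF refl])
    fix b assume b: "b \<in> F"
    have "(\<Sum>k\<in>{0..<int (frame_norm b)}. ee ((of_int k)\<^sup>2 / (2 * B b b)))
        = (\<Sum>k<frame_norm b. ee ((real k)\<^sup>2 / (2 * B b b)))"
      by (rule sum.reindex_bij_witness[of _ int nat]) auto
    then show "(\<Sum>k\<in>{0..<int (frame_norm b)}. ee ((of_int k)\<^sup>2 / (2 * B b b))) = gauss_sum 1 (frame_norm b div 2)"
      using frame_norm_even[OF b] by (simp add: gauss_sum_def)
  qed
  finally show ?thesis .
qed

lemma box_sum_eval:
  obtains P where "P > 0" "(\<Sum>c\<in>frame_box. frame_q (frame_vec c)) = of_real P * (1 + \<i>) ^ card F"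
proof
  show "(\<Prod>b\<in>F. sqrt (real (frame_norm b div 2))) > 0"
    using frame_norm_even by (intro prod_pos) auto
  show "(\<Sum>c\<in>frame_box. frame_q (frame_vec c))
      = of_real (\<Prod>b\<in>F. sqrt (real (frame_norm b div 2))) * (1 + \<i>) ^ card F"
    unfolding box_sum_gauss using gauss_sum_eval frame_norm_even
    by (simp add: prod.distrib)
qed

text \<open>\<open>\<phi>\<close> stands for an isometry onto a cyclic module and \<open>h\<close>
  for the exponential of its form. Each fibre of \<open>\<phi>\<close> in the box is a translate of
  the part lying in \<open>L\<close>, so all values occur equally often, namely as often as the
  index of \<open>M\<close> in \<open>L\<close>.\<close>

lemma dual_sum_fibres:
  fixes \<phi> :: "'v \<Rightarrow> int" and n :: int and h :: "int \<Rightarrow> complex"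
  assumes range: "\<And>x. x \<in> dual_lattice L B \<Longrightarrow> \<phi> x \<in> {0..<n}"
    and add: "\<And>x y. x \<in> dual_lattice L B \<Longrightarrow> y \<in> dual_lattice L B \<Longrightarrow> \<phi> (x + y) = (\<phi> x + \<phi> y) mod n"
    and ker: "\<And>x. x \<in> dual_lattice L B \<Longrightarrow> \<phi> x = 0 \<longleftrightarrow> x \<in> L"
    and surj: "\<And>j. j \<in> {0..<n} \<Longrightarrow> \<exists>x\<in>dual_lattice L B. \<phi> x = j"
    and q: "\<And>x. x \<in> dual_lattice L B \<Longrightarrow> frame_q x = h (\<phi> x)"
  shows "(\<Sum>c\<in>{c \<in> frame_box. frame_vec c \<in> dual_lattice L B}. frame_q (frame_vec c))
    = of_nat (card {c \<in> frame_box. frame_vec c \<in> L}) * (\<Sum>j\<in>{0..<n}. h j)"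
proof -
  let ?D = "dual_lattice L B"
  let ?A = "{c \<in> frame_box. frame_vec c \<in> ?D}"
  have fibre: "card {c \<in> ?A. \<phi> (frame_vec c) = j} = card {c \<in> frame_box. frame_vec c \<in> L}"
    if j: "j \<in> {0..<n}" for j
  proof -
    obtain t where t: "t \<in> ?D" "\<phi> t = j" using surj j by blast
    let ?U = "{x \<in> ?D. \<phi> x = j}"
    have "bij_betw (\<lambda>c. frame_reduce (frame_vec c + t))
        {c \<in> frame_box. frame_vec c \<in> L} {c \<in> frame_box. frame_vec c \<in> ?U}"
    proof (rule frame_shift_bij)
      show "t \<in> frame_dual" using t dual_subset_frame_dual by blast
      show "x + y \<in> L" if "x \<in> L" "y \<in> frame_lattice" for x y
        using that by (rule L_add_frame_lattice)
      show "x + y \<in> ?U" if "x \<in> ?U" "y \<in> frame_lattice" for x y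
      proof -
        have "y \<in> L" "y \<in> ?D" using that frame_lattice_subset L_subset_dual by blast+
        then show ?thesis using that add[of x y] ker[of y] j dual_add[of x y] by simp
      qed
      show "x + t \<in> ?U" if "x \<in> L" for x
      proof -
        have "x \<in> ?D" using that L_subset_dual by blast
        then show ?thesis using that t add[of x t] ker[of x] j dual_add[of x t] by simp
      qed
      show "x - t \<in> L" if "x \<in> ?U" for x
      proof -
        have d: "x - t \<in> ?D" using that t dual_diff by simp
        have "(\<phi> (x - t) + j) mod n = j" using add[OF d t(1)] that t by simp
        then have "\<phi> (x - t) = 0" using range[OF d] j by (intro int_add_mod_eq_self) auto
        then show ?thesis using ker[OF d] by simp
      qed
    qed
    from bij_betw_same_card[OF this] show ?thesis by (simp add: conj_assoc)
  qed
  have "(\<Sum>c\<in>?A. frame_q (frame_vec c)) = (\<Sum>c\<in>?A. h (\<phi> (frame_vec c)))"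
    using q by (intro sum.cong) auto
  also have "\<dots> = (\<Sum>j\<in>{0..<n}. \<Sum>c\<in>{c \<in> ?A. \<phi> (frame_vec c) = j}. h (\<phi> (frame_vec c)))"
    using range finite_frame_box by (intro sum.group[symmetric]) auto
  also have "\<dots> = (\<Sum>j\<in>{0..<n}. of_nat (card {c \<in> frame_box. frame_vec c \<in> L}) * h j)"
  proof (rule sum.cong[OF refl])
    fix j assume j: "j \<in> {0..<n}"
    have "(\<Sum>c\<in>{c \<in> ?A. \<phi> (frame_vec c) = j}. h (\<phi> (frame_vec c)))
        = (\<Sum>c\<in>{c \<in> ?A. \<phi> (frame_vec c) = j}. h j)" by (rule sum.cong) auto
    then show "(\<Sum>c\<in>{c \<in> ?A. \<phi> (frame_vec c) = j}. h (\<phi> (frame_vec c)))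
        = of_nat (card {c \<in> frame_box. frame_vec c \<in> L}) * h j"
      by (simp only: sum_constant fibre[OF j])
  qed
  finally show ?thesis by (simp add: sum_distrib_left)
qed

end

text \<open>With r = 2u + 1 the order is 2m for m = (2^u)^2, and the odd \<open>a\<close> is prime
  to 2^u, so the scaling by squares leads back to \<open>gauss_sum a 1\<close>.\<close>

lemma gauss_sum_2_power:
  assumes "odd r" "odd a"
  shows "(\<Sum>j\<in>{0..<2 ^ r}. ee (of_int a / 2 ^ (r + 1) * (of_int j)\<^sup>2)) = 2 ^ ((r - 1) div 2) * (1 + ee (of_int a / 4))"
proof -
  obtain u where r: "r = 2 * u + 1" using assms(1) by (auto elim: oddE)
  have p: "(2::nat) ^ (2 * u) = 1 * (2 ^ u)\<^sup>2" by (simp add: power_even_eq)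
  have "(\<Sum>j\<in>{0..<2 ^ r}. ee (of_int a / 2 ^ (r + 1) * (of_int j)\<^sup>2))
      = (\<Sum>j<2 ^ r. ee (of_int a / 2 ^ (r + 1) * (real j)\<^sup>2))"
    by (rule sum.reindex_bij_witness[of _ int nat]) (auto simp: nat_less_iff)
  also have "\<dots> = gauss_sum a (2 ^ (2 * u))"
    by (simp add: gauss_sum_def r)
  also have "\<dots> = of_nat (2 ^ u) * gauss_sum a 1"
    unfolding p using assms(2) by (intro gauss_sum_mult_square) auto
  finally show ?thesis by (simp only: gauss_sum_1) (simp add: r)
qed

lemma ee_fourth:
  "a mod 4 = 1 \<Longrightarrow> ee (of_int a / 4) = \<i>"
  "a mod 4 = 3 \<Longrightarrow> ee (of_int a / 4) = - \<i>"
proof -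
  have *: "ee (of_int a / 4) = ee (of_int (a mod 4) / 4)"
  proof (rule ee_cong)
    have "a = 4 * (a div 4) + a mod 4" by simp
    then have "(of_int a :: real) = 4 * of_int (a div 4) + of_int (a mod 4)"
      by (metis of_int_add of_int_mult of_int_numeral)
    then have "of_int a / 4 - of_int (a mod 4) / 4 = (of_int (a div 4) :: real)" by (simp add: add_divide_distrib)
    then show "of_int a / 4 - of_int (a mod 4) / 4 \<in> (\<int> :: real set)" by simp
  qed
  have "ee (3 / 4) = ee (1 / 4) ^ 3" by (simp add: ee_power)
  then have "ee (3 / 4) = - \<i>" by (simp add: ee_quarter power3_eq_cube)
  then show "a mod 4 = 1 \<Longrightarrow> ee (of_int a / 4) = \<i>" "a mod 4 = 3 \<Longrightarrow> ee (of_int a / 4) = - \<i>"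
    by (simp_all add: * ee_quarter)
qed

text \<open>(1 + i)^8 = 16 is positive, and the eight powers below it lie on different rays from the
  origin; 1 + i and 1 - i are the rays of the exponents 1 and 7.\<close>

lemma one_plus_i_power_mod_8:
  fixes R :: real
  assumes "R > 0"
  shows "(1 + \<i>) ^ n = of_real R * (1 + \<i>) \<Longrightarrow> n mod 8 = 1"
    and "(1 + \<i>) ^ n = of_real R * (1 - \<i>) \<Longrightarrow> n mod 8 = 7"
proof -
  have sq: "(1 + \<i>) ^ 2 = 2 * \<i>" by (simp add: complex_eq_iff power2_eq_square)
  have p: "(1 + \<i>) ^ 3 = 2 * \<i> * (1 + \<i>)" "(1 + \<i>) ^ 4 = - 4" "(1 + \<i>) ^ 5 = - 4 * (1 + \<i>)"
    "(1 + \<i>) ^ 6 = - 8 * \<i>" "(1 + \<i>) ^ 7 = - 8 * \<i> * (1 + \<i>)" "(1 + \<i>) ^ 8 = 16"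
    by (simp_all add: complex_eq_iff eval_nat_numeral algebra_simps)
  have "(1 + \<i>) ^ n = (1 + \<i>) ^ (8 * (n div 8) + n mod 8)" by simp
  then have n: "(1 + \<i>) ^ n = of_real (16 ^ (n div 8)) * (1 + \<i>) ^ (n mod 8)"
    by (simp only: power_add power_mult p) simp
  define T :: real where "T = 16 ^ (n div 8)"
  have T: "T > 0" by (simp add: T_def)
  have "n mod 8 < 8" by simp
  then have c: "n mod 8 \<in> {0, 1, 2, 3, 4, 5, 6, 7}" by auto
  show "(1 + \<i>) ^ n = of_real R * (1 + \<i>) \<Longrightarrow> n mod 8 = 1"
    using c assms T unfolding n T_def[symmetric] by (auto simp: complex_eq_iff sq p)
  show "(1 + \<i>) ^ n = of_real R * (1 - \<i>) \<Longrightarrow> n mod 8 = 7"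
    using c assms T unfolding n T_def[symmetric] by (auto simp: complex_eq_iff sq p)
qed

lemma mod_int_eq_iff: "mod_int x = mod_int y \<longleftrightarrow> x - y \<in> \<int>"
proof
  assume "mod_int x = mod_int y"
  moreover have "x \<in> mod_int x" unfolding mod_int_def mem_Collect_eq by (rule exI[of _ 0]) simp
  ultimately obtain k :: int where "x = y + of_int k" by (auto simp: mod_int_def)
  then show "x - y \<in> \<int>" by simp
next
  assume "x - y \<in> \<int>"
  then obtain k :: int where "x - y = of_int k" by (auto elim: Ints_cases)
  then have x: "x = y + of_int k" by simp
  have "\<exists>l. y + of_int k + of_int j = y + of_int l" for j :: int
    by (rule exI[of _ "k + j"]) simp
  moreover have "\<exists>l. y + of_int j = y + of_int k + of_int l" for j :: int
    by (rule exI[of _ "j - k"]) simp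
  ultimately show "mod_int x = mod_int y" unfolding x mod_int_def by blast
qed

section \<open>Cosets in the dual lattice, isometries, and the rank modulo 8\<close>

context pos_even_lattice
begin

abbreviation dual_group :: "'v monoid" where
  "dual_group \<equiv> \<lparr>carrier = dual_lattice L B, mult = (+), one = 0\<rparr>"

lemma coset_eq_iff: "L #>\<^bsub>dual_group\<^esub> x = L #>\<^bsub>dual_group\<^esub> y \<longleftrightarrow> x - y \<in> L"
proof
  assume eq: "L #>\<^bsub>dual_group\<^esub> x = L #>\<^bsub>dual_group\<^esub> y"
  have "x \<in> L #>\<^bsub>dual_group\<^esub> x" using L_zero by (force simp: r_coset_def)
  then obtain l where "l \<in> L" "x = l + y" unfolding eq by (auto simp: r_coset_def)
  then show "x - y \<in> L" by simp
next
  assume d: "x - y \<in> L"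
  have "\<exists>h\<in>L. l + x = h + y" if "l \<in> L" for l
    using L_add[OF that d] by (intro bexI[of _ "l + (x - y)"]) auto
  moreover have "\<exists>h\<in>L. l + y = h + x" if "l \<in> L" for l
    using L_diff[OF that d] by (intro bexI[of _ "l - (x - y)"]) auto
  ultimately show "L #>\<^bsub>dual_group\<^esub> x = L #>\<^bsub>dual_group\<^esub> y"
    by (auto simp: r_coset_def)
qed

lemma coset_mult:
  "(L #>\<^bsub>dual_group\<^esub> x) <#>\<^bsub>dual_group\<^esub> (L #>\<^bsub>dual_group\<^esub> y) = L #>\<^bsub>dual_group\<^esub> (x + y)"
proof -
  have "\<exists>h\<in>L. l + x + (m + y) = h + (x + y)" if "l \<in> L" "m \<in> L" for l m
    using L_add[OF that] by (intro bexI[of _ "l + m"]) auto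
  moreover have "\<exists>m\<in>L. \<exists>k\<in>L. l + (x + y) = m + x + (k + y)" if "l \<in> L" for l
    using that L_zero by (intro bexI[of _ l] bexI[of _ 0]) auto
  ultimately show ?thesis by (auto simp: r_coset_def set_mult_def)
qed

lemma carrier_disc_module: "carrier (fst (disc_module L B)) = (\<lambda>x. L #>\<^bsub>dual_group\<^esub> x) ` dual_lattice L B"
  by (auto simp: disc_module_def FactGroup_def RCOSETS_def)

lemma mult_disc_module:
  "(L #>\<^bsub>dual_group\<^esub> x) \<otimes>\<^bsub>fst (disc_module L B)\<^esub> (L #>\<^bsub>dual_group\<^esub> y) = L #>\<^bsub>dual_group\<^esub> (x + y)"
  by (simp add: disc_module_def FactGroup_def coset_mult)

text \<open>The isometry is composed with the projection from the dual lattice. What remains is a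
  residue-valued function, so later arguments compute with vectors and integers instead of
  cosets.\<close>

lemma isometric_A_moduleE:
  assumes lf: "lattice_form L B" and iso: "isometric (disc_module L B) (A_module r a)"
  obtains \<phi> :: "'v \<Rightarrow> int" where
    "\<And>x. x \<in> dual_lattice L B \<Longrightarrow> \<phi> x \<in> {0..<2 ^ r}"
    "\<And>x y. x \<in> dual_lattice L B \<Longrightarrow> y \<in> dual_lattice L B \<Longrightarrow> \<phi> (x + y) = (\<phi> x + \<phi> y) mod 2 ^ r"
    "\<And>x. x \<in> dual_lattice L B \<Longrightarrow> \<phi> x = 0 \<longleftrightarrow> x \<in> L"
    "\<And>j. j \<in> {0..<2 ^ r} \<Longrightarrow> \<exists>x\<in>dual_lattice L B. \<phi> x = j"
    "\<And>x. x \<in> dual_lattice L B \<Longrightarrow> B x x / 2 - of_int a / 2 ^ (r + 1) * (of_int (\<phi> x))\<^sup>2 \<in> \<int>"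
proof -
  let ?D = "dual_lattice L B"
  let ?C = "\<lambda>x. L #>\<^bsub>dual_group\<^esub> x"
  obtain f where f: "f \<in> iso (fst (disc_module L B)) (integer_mod_group (2 ^ r))"
    and q: "\<And>X. X \<in> carrier (fst (disc_module L B)) \<Longrightarrow>
      mod_int (of_int a / 2 ^ (r + 1) * (of_int (f X))\<^sup>2) = snd (disc_module L B) X"
    using iso by (auto simp: isometric_def A_module_def)
  have carr: "carrier (integer_mod_group (2 ^ r)) = {0..<2 ^ r}"
    by (simp add: carrier_integer_mod_group)
  have bij: "bij_betw f (?C ` ?D) {0..<2 ^ r}"
    using f by (simp add: iso_def carrier_disc_module carr)
  have 1: "f (?C x) \<in> {0..<2 ^ r}" if "x \<in> ?D" for x
    using bij that by (auto simp: bij_betw_def)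
  have 2: "f (?C (x + y)) = (f (?C x) + f (?C y)) mod 2 ^ r" if "x \<in> ?D" "y \<in> ?D" for x y
  proof -
    have "f (?C x \<otimes>\<^bsub>fst (disc_module L B)\<^esub> ?C y) = f (?C x) \<otimes>\<^bsub>integer_mod_group (2 ^ r)\<^esub> f (?C y)"
      using f that by (intro hom_mult[of f "fst (disc_module L B)"]) (auto simp: iso_def carrier_disc_module)
    then show ?thesis by (simp add: mult_disc_module)
  qed
  have z: "0 \<in> ?D" using L_zero L_subset_dual by blast
  have f0: "f (?C 0) = 0"
  proof -
    have "(f (?C 0) + f (?C 0)) mod 2 ^ r = f (?C 0)" using 2[OF z z] by (simp only: add_0)
    from int_add_mod_eq_self[OF this] show ?thesis using 1[OF z] by auto
  qed
  have 3: "f (?C x) = 0 \<longleftrightarrow> x \<in> L" if x: "x \<in> ?D" for x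
  proof -
    have "f (?C x) = f (?C 0) \<longleftrightarrow> ?C x = ?C 0"
      using bij x z by (auto simp: bij_betw_def inj_on_def)
    then show ?thesis unfolding f0 by (simp add: coset_eq_iff)
  qed
  have 4: "\<exists>x\<in>?D. f (?C x) = j" if "j \<in> {0..<2 ^ r}" for j
    using bij that by (auto simp: bij_betw_def image_iff) (metis (no_types, lifting) image_iff that)
  have 5: "B x x / 2 - of_int a / 2 ^ (r + 1) * (of_int (f (?C x)))\<^sup>2 \<in> \<int>" if x: "x \<in> ?D" for x
    using q[of "?C x"] disc_module_form[OF lf even x] x
    by (simp add: carrier_disc_module mod_int_eq_iff[symmetric])
  show ?thesis by (rule that[of "\<lambda>x. f (?C x)"]) (fact 1 2 3 4 5)+
qed

theorem rank_mod_8: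
  assumes lf: "lattice_form L B" and iso: "isometric (disc_module L B) (A_module r a)" and odd: "odd r"
  shows "a mod 4 = 1 \<Longrightarrow> card S mod 8 = 1" "a mod 4 = 3 \<Longrightarrow> card S mod 8 = 7"
proof -
  obtain F where F: "finite F" "F \<subseteq> L" "0 \<notin> F" "\<forall>b\<in>F. \<forall>c\<in>F. b \<noteq> c \<longrightarrow> B b c = 0"
      "span F = span S" "card F = card S"
    using orthogonal_subset_exists[OF S(1) S_subset S(2)] by (elim exE conjE) (rule that)
  interpret orthogonal_frame L B S F
    by unfold_locales (fact F(1-4) F(5)[unfolded span_S])+
  obtain \<phi> :: "'v \<Rightarrow> int" where \<phi>:
    "\<And>x. x \<in> dual_lattice L B \<Longrightarrow> \<phi> x \<in> {0..<2 ^ r}"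
    "\<And>x y. x \<in> dual_lattice L B \<Longrightarrow> y \<in> dual_lattice L B \<Longrightarrow> \<phi> (x + y) = (\<phi> x + \<phi> y) mod 2 ^ r"
    "\<And>x. x \<in> dual_lattice L B \<Longrightarrow> \<phi> x = 0 \<longleftrightarrow> x \<in> L"
    "\<And>j. j \<in> {0..<2 ^ r} \<Longrightarrow> \<exists>x\<in>dual_lattice L B. \<phi> x = j"
    "\<And>x. x \<in> dual_lattice L B \<Longrightarrow> B x x / 2 - of_int a / 2 ^ (r + 1) * (of_int (\<phi> x))\<^sup>2 \<in> \<int>"
    by (rule isometric_A_moduleE[OF lf iso]) (rule that)
  obtain P where P: "P > 0" "(\<Sum>c\<in>frame_box. frame_q (frame_vec c)) = of_real P * (1 + \<i>) ^ card F"
    by (rule box_sum_eval)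
  \<comment> \<open>The index of \<open>M\<close> in \<open>L\<close>.\<close>
  define K :: nat where "K = card {c \<in> frame_box. frame_vec c \<in> L}"
  have K: "K > 0" unfolding K_def by (rule card_box_L_pos)
  have "of_real P * (1 + \<i>) ^ card S
      = of_nat K * (\<Sum>j\<in>{0..<2 ^ r}. ee (of_int a / 2 ^ (r + 1) * (of_int j)\<^sup>2))"
    unfolding F(6)[symmetric] P(2)[symmetric] box_sum_dual K_def
    using \<phi>(5) by (intro dual_sum_fibres[of \<phi>] \<phi>(1-4)) (auto simp: frame_q_def intro: ee_cong)
  then have eq: "of_real P * (1 + \<i>) ^ card S = of_nat K * (2 ^ ((r - 1) div 2) * (1 + ee (of_int a / 4)))"
    if "odd a" using gauss_sum_2_power[OF odd that] by simp
  \<comment> \<open>All positive factors are collected in \<open>R\<close>, as only the direction of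
    the power of 1 + i matters.\<close>
  define R where "R = real K * 2 ^ ((r - 1) div 2) / P"
  have R: "R > 0" using K P by (simp add: R_def)
  have eq': "(1 + \<i>) ^ card S = of_real R * (1 + ee (of_int a / 4))" if "odd a"
    using eq[OF that] P(1) by (simp add: R_def field_simps)
  show "card S mod 8 = 1" if "a mod 4 = 1"
  proof (rule one_plus_i_power_mod_8(1)[OF R])
    have "odd a" using that by presburger
    from eq'[OF this] show "(1 + \<i>) ^ card S = of_real R * (1 + \<i>)" by (simp only: ee_fourth(1)[OF that])
  qed
  show "card S mod 8 = 7" if "a mod 4 = 3"
  proof (rule one_plus_i_power_mod_8(2)[OF R])
    have "odd a" using that by presburger
    from eq'[OF this] show "(1 + \<i>) ^ card S = of_real R * (1 - \<i>)" by (simp add: ee_fourth(2)[OF that])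
  qed
qed

end

section \<open>Cyclic discriminant modules\<close>

lemma odd_square_minus_one:
  fixes j :: int
  assumes "odd j"
  shows "8 dvd j\<^sup>2 - 1"
proof -
  obtain i where j: "j = 2 * i + 1" using assms by (auto elim: oddE)
  have "even (i * (i + 1))" by simp
  then obtain l where "i * (i + 1) = 2 * l" by blast
  then have "j\<^sup>2 - 1 = 8 * l" by (simp add: j power2_eq_square algebra_simps)
  then show ?thesis by simp
qed

context pos_even_lattice
begin

text \<open>Here \<open>L\<close> consists of the integer multiples of \<open>s\<close>, and its
  dual is generated by \<open>t = s / N\<close>, of norm 1 / N. As 2^r t lies in \<open>L\<close>,
  2^r = m N for an integer \<open>m\<close>, and comparing the forms at \<open>t\<close> gives m = a
  j^2 modulo 2^(r+1) with j = \<open>\<phi> t\<close> odd. So \<open>m\<close> is an odd positive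
  divisor of 2^r, hence 1, and \<open>a\<close> is 1 modulo 8 because odd squares are.\<close>

lemma rank_one_A_module:
  assumes lf: "lattice_form L B" and iso: "isometric (disc_module L B) (A_module r a)"
    and r: "r > 1" and a: "odd a" and card: "card S = 1"
  shows "a mod 8 = 1"
proof -
  let ?D = "dual_lattice L B"
  obtain s where s: "S = {s}" using card by (auto simp: card_1_singleton_iff)
  have sL: "s \<in> L" using S_subset s by simp
  have s0: "s \<noteq> 0" using S(2) s by (auto simp: dependent_zero)
  have L_s: "\<exists>m::int. x = of_int m *\<^sub>R s" if "x \<in> L" for x
    using that by (auto simp: L_iff s)
  define N where "N = B s s"
  have N: "N > 0" using B_pos[OF sL s0] by (simp add: N_def)
  define t where "t = (1 / N) *\<^sub>R s"
  have tD: "t \<in> ?D"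
  proof -
    have "B t w \<in> \<int>" if "w \<in> L" for w
      using L_s[OF that] N by (auto simp: t_def B_scale_left B_scale_right N_def[symmetric])
    then show ?thesis using sL by (auto simp: dual_lattice_def t_def intro: span_base span_scale)
  qed
  have gen: "\<exists>k::int. x = of_int k *\<^sub>R t" if x: "x \<in> ?D" for x
  proof -
    obtain u where u: "x = u *\<^sub>R s" using x span_S s by (auto simp: dual_lattice_def span_singleton)
    obtain k :: int where "B x s = of_int k" using x sL by (auto simp: dual_lattice_def elim: Ints_cases)
    then have "u = of_int k / N" using N by (simp add: u B_scale_left N_def[symmetric] field_simps)
    then show ?thesis by (auto simp: u t_def)
  qed
  obtain \<phi> :: "'v \<Rightarrow> int" where \<phi>:
    "\<And>x. x \<in> ?D \<Longrightarrow> \<phi> x \<in> {0..<2 ^ r}"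
    "\<And>x y. x \<in> ?D \<Longrightarrow> y \<in> ?D \<Longrightarrow> \<phi> (x + y) = (\<phi> x + \<phi> y) mod 2 ^ r"
    "\<And>x. x \<in> ?D \<Longrightarrow> \<phi> x = 0 \<longleftrightarrow> x \<in> L"
    "\<And>j. j \<in> {0..<2 ^ r} \<Longrightarrow> \<exists>x\<in>?D. \<phi> x = j"
    "\<And>x. x \<in> ?D \<Longrightarrow> B x x / 2 - of_int a / 2 ^ (r + 1) * (of_int (\<phi> x))\<^sup>2 \<in> \<int>"
    by (rule isometric_A_moduleE[OF lf iso]) (rule that)
  define j where "j = \<phi> t"
  have nat_mult: "[\<phi> (of_int (int n) *\<^sub>R t) = int n * j] (mod 2 ^ r)" for n
  proof (induction n)
    case 0
    have "0 \<in> ?D" using L_zero L_subset_dual by blast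
    then show ?case using \<phi>(3)[of 0] L_zero by simp
  next
    case (Suc n)
    have "of_int (int (Suc n)) *\<^sub>R t = of_int (int n) *\<^sub>R t + t" by (simp add: scaleR_add_left)
    then have "\<phi> (of_int (int (Suc n)) *\<^sub>R t) = (\<phi> (of_int (int n) *\<^sub>R t) + j) mod 2 ^ r"
      using \<phi>(2)[OF dual_scale[OF tD] tD, of "int n"] by (simp only: j_def)
    then have "[\<phi> (of_int (int (Suc n)) *\<^sub>R t) = \<phi> (of_int (int n) *\<^sub>R t) + j] (mod 2 ^ r)"
      by (simp add: cong_def)
    also have "[\<phi> (of_int (int n) *\<^sub>R t) + j = int n * j + j] (mod 2 ^ r)"
      using Suc by (intro cong_add) auto
    finally show ?case by (simp add: algebra_simps)
  qed
  \<comment> \<open>As \<open>t\<close> generates the dual lattice, an even \<open>j\<close> would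
    make all values of \<open>\<phi>\<close> even, although 1 is a value.\<close>
  have odd_j: "odd j"
  proof
    assume ev: "even j"
    have "(1::int) < 2 ^ r" using r by simp
    then obtain x where x: "x \<in> ?D" "\<phi> x = 1" using \<phi>(4)[of 1] by auto
    obtain k :: int where k: "x = of_int k *\<^sub>R t" using gen[OF x(1)] by blast
    have two: "(2::int) dvd 2 ^ r" using r by (simp add: dvd_power)
    have even_n: "even (\<phi> (of_int (int n) *\<^sub>R t))" for n
      using cong_dvd_iff[OF cong_dvd_modulus[OF nat_mult[of n] two]] ev by simp
    show False
    proof (cases "k \<ge> 0")
      case True
      then show False using even_n[of "nat k"] x k by simp
    next
      case False
      \<comment> \<open>\<open>nat_mult\<close> covers nonnegative multiples only; a negative
        multiple is handled through its inverse \<open>?y\<close>.\<close>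
      let ?y = "of_int (int (nat (- k))) *\<^sub>R t"
      have xy: "x + ?y = 0" using False by (simp add: k flip: scaleR_add_left)
      have "\<phi> (x + ?y) = (\<phi> x + \<phi> ?y) mod 2 ^ r"
        by (rule \<phi>(2)[OF x(1) dual_scale[OF tD]])
      then have "\<phi> 0 = (1 + \<phi> ?y) mod 2 ^ r" by (simp only: xy x(2))
      moreover have "\<phi> 0 = 0" using \<phi>(3)[of 0] L_zero L_subset_dual by blast
      ultimately have "2 ^ r dvd 1 + \<phi> ?y" by (metis dvd_eq_mod_eq_0)
      then have "even (1 + \<phi> ?y)" using two dvd_trans by blast
      then show False using even_n[of "nat (- k)"] by simp
    qed
  qed
  have "\<phi> (of_int (int (2 ^ r)) *\<^sub>R t) = 0"
  proof -
    have "[\<phi> (of_int (int (2 ^ r)) *\<^sub>R t) = 0] (mod 2 ^ r)"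
      using nat_mult[of "2 ^ r"] by (simp add: cong_def)
    then show ?thesis using \<phi>(1)[OF dual_scale[OF tD], of "int (2 ^ r)"] by (simp add: cong_def)
  qed
  then have "of_int (int (2 ^ r)) *\<^sub>R t \<in> L" using \<phi>(3)[OF dual_scale[OF tD]] by blast
  then obtain m :: int where "of_int (int (2 ^ r)) *\<^sub>R t = of_int m *\<^sub>R s" using L_s by blast
  then have m: "2 ^ r = of_int m * N" using s0 N by (simp add: t_def field_simps)
  have m0: "m > 0"
  proof -
    have "of_int m * N > 0" using m by (metis zero_less_numeral zero_less_power)
    then show ?thesis using N by (simp add: zero_less_mult_iff)
  qed
  obtain k :: int where "B t t / 2 - of_int a / 2 ^ (r + 1) * (of_int j)\<^sup>2 = of_int k"
    using \<phi>(5)[OF tD] by (auto simp: j_def elim: Ints_cases)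
  moreover have "B t t = of_int m / 2 ^ r"
    using N m m0 by (simp add: t_def B_scale_left B_scale_right N_def[symmetric])
  ultimately have "(of_int m :: real) - of_int a * (of_int j)\<^sup>2 = of_int k * 2 ^ (r + 1)"
    by (simp add: field_simps)
  then have "(of_int (m - a * j\<^sup>2) :: real) = of_int (k * 2 ^ (r + 1))" by simp
  then have eq: "m - a * j\<^sup>2 = k * 2 ^ (r + 1)" by (simp only: of_int_eq_iff)
  have "N \<in> \<int>" unfolding N_def using sL by (intro B_Ints)
  then obtain n :: int where n: "N = of_int n" by (auto elim: Ints_cases)
  have "m * n = 2 ^ r"
  proof -
    have "(of_int (m * n) :: real) = of_int (2 ^ r)" using m n by simp
    then show ?thesis by (simp only: of_int_eq_iff)
  qed
  then have "m dvd 2 ^ r" by (metis dvd_triv_left)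
  moreover have "odd m"
  proof
    assume "even m"
    moreover have "odd (a * j\<^sup>2)" using a odd_j by simp
    ultimately have "odd (m - a * j\<^sup>2)" by simp
    then show False unfolding eq by simp
  qed
  then have "coprime m (2 ^ r)" by (simp add: coprime_power_right_iff)
  ultimately have "is_unit m" by (metis coprime_common_divisor dvd_refl)
  then have "m = 1" using m0 by simp
  then have "1 - a * j\<^sup>2 = k * 2 ^ (r + 1)" using eq by simp
  moreover have "(8::int) dvd 2 ^ (r + 1)"
    using r le_imp_power_dvd[of 3 "r + 1" "2::int"] by simp
  ultimately have "8 dvd 1 - a * j\<^sup>2" by simp
  moreover have "8 dvd j\<^sup>2 - 1" using odd_j by (rule odd_square_minus_one)
  then have "8 dvd a * (j\<^sup>2 - 1)" by (rule dvd_mult)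
  ultimately have "8 dvd (1 - a * j\<^sup>2) + a * (j\<^sup>2 - 1)" by (rule dvd_add)
  then have "8 dvd 1 - a" by (simp add: algebra_simps)
  then show ?thesis by presburger
qed

end

text \<open>Hensel lifting at 2. If the error divided by 2^(k+3) is an odd \<open>w\<close>, adding
  2^(k+2) to \<open>u\<close> changes u^2 by 2^(k+3) u modulo 2^(k+4); since \<open>u\<close> is
  odd, the new quotient is even.\<close>

lemma square_mod_2_power:
  fixes c :: int
  assumes "c mod 8 = 1"
  shows "\<exists>u. odd u \<and> 2 ^ (k + 3) dvd c - u\<^sup>2"
proof (induction k)
  case 0
  have "8 dvd c - 1" using assms by presburger
  then show ?case by (intro exI[of _ 1]) simp
next
  case (Suc k)
  then obtain u w where u: "odd u" and w: "c - u\<^sup>2 = 2 ^ (k + 3) * w" by (auto simp: dvd_def)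
  show ?case
  proof (cases "even w")
    case True
    then obtain z where "w = 2 * z" by blast
    then have "c - u\<^sup>2 = 2 ^ (Suc k + 3) * z" using w by (simp add: power_add)
    then show ?thesis using u by (intro exI[of _ u]) simp
  next
    case False
    then have "even (w - u)" using u by simp
    then obtain z where z: "w - u = 2 * z" by (elim evenE)
    have "c - (u + 2 ^ (k + 2))\<^sup>2 = 2 ^ (k + 3) * (w - u) - 2 ^ (k + 4) * 2 ^ k"
      using w by (simp add: power2_eq_square power_add algebra_simps)
    also have "\<dots> = 2 ^ (Suc k + 3) * (z - 2 ^ k)" by (simp add: z power_add algebra_simps)
    finally show ?thesis using u by (intro exI[of _ "u + 2 ^ (k + 2)"]) auto
  qed
qed

context pos_even_lattice
begin

text \<open>The generator \<open>t\<close> has form value p / 2^(r+1). Multiplying it by a unit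
  \<open>u\<close> with p u^2 = a modulo 2^(r+1) gives a generator with value a / 2^(r+1), the image
  of 1 under the inverse of the isometry.\<close>

lemma isometric_A_moduleI:
  fixes t :: 'v and p a :: int
  assumes lf: "lattice_form L B" and tD: "t \<in> dual_lattice L B"
    and Bt: "B t t = of_int p / 2 ^ r" and p: "odd p" and ap: "[a = p] (mod 8)"
    and tL: "2 ^ r *\<^sub>R t \<in> L"
    and gen: "\<And>w. w \<in> dual_lattice L B \<Longrightarrow> \<exists>k::int. w - of_int k *\<^sub>R t \<in> L"
  shows "isometric (disc_module L B) (A_module r a)"
proof -
  let ?D = "dual_lattice L B"
  let ?C = "\<lambda>x. L #>\<^bsub>dual_group\<^esub> x"
  \<comment> \<open>\<open>q\<close> plays the part of 1 / p. The modulus is the one that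
    \<open>square_mod_2_power\<close> delivers for \<open>k = r\<close>, and being a multiple of 8
    it gives \<open>a * q\<close> the residue 1.\<close>
  obtain q where q: "[p * q = 1] (mod 2 ^ (r + 3))"
    using p cong_solve_coprime_int[of p "2 ^ (r + 3)"] by (auto simp: coprime_power_right_iff)
  have "a * q mod 8 = 1"
  proof -
    have "(8::int) dvd 2 ^ (r + 3)" by (simp add: power_add)
    then have "[p * q = 1] (mod 8)" using q cong_dvd_modulus by blast
    moreover have "[a * q = p * q] (mod 8)" using ap by (intro cong_mult) auto
    ultimately have "[a * q = 1] (mod 8)" using cong_trans by blast
    then show ?thesis by (simp add: cong_def)
  qed
  then obtain u where u: "odd u" "2 ^ (r + 3) dvd a * q - u\<^sup>2" using square_mod_2_power by blast
  have pu: "[p * u\<^sup>2 = a] (mod 2 ^ (r + 1))"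
  proof -
    have "[p * u\<^sup>2 = p * (a * q)] (mod 2 ^ (r + 3))"
      using u(2) by (intro cong_mult) (auto simp: cong_iff_dvd_diff dvd_diff_commute)
    also have "p * (a * q) = a * (p * q)" by simp
    also have "[a * (p * q) = a * 1] (mod 2 ^ (r + 3))" using q by (intro cong_mult) auto
    finally show ?thesis using le_imp_power_dvd[of "r + 1" "r + 3" "2::int"]
      by (auto intro: cong_dvd_modulus)
  qed
  then obtain e where e: "p * u\<^sup>2 - a = 2 ^ (r + 1) * e" by (auto simp: cong_iff_dvd_diff dvd_def)
  obtain u' where u': "[u * u' = 1] (mod 2 ^ r)"
    using u(1) cong_solve_coprime_int[of u "2 ^ r"] by (auto simp: coprime_power_right_iff)
  have mult_L: "of_int k *\<^sub>R t \<in> L" if dvd: "2 ^ r dvd k" for k :: int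
  proof -
    obtain l where "k = 2 ^ r * l" using dvd by blast
    then have "of_int k *\<^sub>R t = of_int l *\<^sub>R (2 ^ r *\<^sub>R t)" by (simp add: mult.commute)
    then show ?thesis by (simp only: L_scale[OF tL])
  qed
  have mult_L_iff: "2 ^ r dvd k" if "of_int k *\<^sub>R t \<in> L" for k :: int
  proof -
    have "B t (of_int k *\<^sub>R t) \<in> \<int>" using tD that by (auto simp: dual_lattice_def)
    then obtain l :: int where "of_int k * of_int p / 2 ^ r = (of_int l :: real)"
      by (auto simp: B_scale_right Bt elim: Ints_cases)
    then have "(of_int (k * p) :: real) = of_int (2 ^ r * l)" by (simp add: field_simps)
    then have "k * p = 2 ^ r * l" by (simp only: of_int_eq_iff)
    then have "2 ^ r dvd k * p" by simp
    moreover have "coprime (2 ^ r) p" using p by simp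
    ultimately show ?thesis by (simp add: coprime_dvd_mult_left_iff)
  qed
  \<comment> \<open>The isomorphism is built from residues to cosets, where it is explicit, and
    inverted at the end.\<close>
  define g where "g j = ?C (of_int (j * u) *\<^sub>R t)" for j :: int
  have gD: "of_int (j * u) *\<^sub>R t \<in> ?D" for j using dual_scale[OF tD] by blast
  have carr: "carrier (integer_mod_group (2 ^ r)) = {0..<2 ^ r}"
    by (simp add: carrier_integer_mod_group)
  have g_eq: "g i = g j \<longleftrightarrow> 2 ^ r dvd i - j" for i j
  proof -
    have "of_int (i * u) *\<^sub>R t - of_int (j * u) *\<^sub>R t = of_int ((i - j) * u) *\<^sub>R t"
      by (simp add: scaleR_diff_left left_diff_distrib)
    then have "g i = g j \<longleftrightarrow> of_int ((i - j) * u) *\<^sub>R t \<in> L" by (simp only: g_def coset_eq_iff)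
    also have "\<dots> \<longleftrightarrow> 2 ^ r dvd (i - j) * u" using mult_L mult_L_iff by blast
    also have "\<dots> \<longleftrightarrow> 2 ^ r dvd i - j" using u(1) by (simp add: coprime_dvd_mult_left_iff)
    finally show ?thesis .
  qed
  have hom: "g \<in> hom (integer_mod_group (2 ^ r)) (fst (disc_module L B))"
  proof (rule homI)
    show "g x \<in> carrier (fst (disc_module L B))" for x
      unfolding carrier_disc_module g_def using gD by blast
    show "g (x \<otimes>\<^bsub>integer_mod_group (2 ^ r)\<^esub> y) = g x \<otimes>\<^bsub>fst (disc_module L B)\<^esub> g y" for x y
    proof -
      have "g x \<otimes>\<^bsub>fst (disc_module L B)\<^esub> g y = g (x + y)"
        unfolding g_def mult_disc_module by (simp add: scaleR_add_left distrib_right)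
      also have "\<dots> = g ((x + y) mod 2 ^ r)" unfolding g_eq by (simp add: minus_mod_eq_mult_div)
      finally show ?thesis by simp
    qed
  qed
  have inj: "inj_on g {0..<2 ^ r}"
  proof (rule inj_onI)
    fix i j :: int assume ij: "i \<in> {0..<2 ^ r}" "j \<in> {0..<2 ^ r}" "g i = g j"
    then have "i mod 2 ^ r = j mod 2 ^ r" unfolding mod_eq_dvd_iff g_eq by blast
    then show "i = j" using ij by (metis atLeastLessThan_iff mod_pos_pos_trivial)
  qed
  have surj: "\<exists>j\<in>{0..<2 ^ r}. X = g j" if X: "X \<in> carrier (fst (disc_module L B))" for X
  proof -
    obtain w where w: "w \<in> ?D" "X = ?C w" using X by (auto simp: carrier_disc_module)
    obtain k :: int where k: "w - of_int k *\<^sub>R t \<in> L" using gen[OF w(1)] by blast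
    \<comment> \<open>\<open>u'\<close> inverts \<open>u\<close> modulo 2^r, so the class of
      \<open>k\<close> times \<open>t\<close> is the value of \<open>g\<close> at
      \<open>k * u'\<close>.\<close>
    have "of_int (k - k * u' * u) *\<^sub>R t \<in> L"
    proof (rule mult_L)
      have "2 ^ r dvd k * (1 - u * u')" using u' by (simp add: cong_iff_dvd_diff dvd_diff_commute)
      then show "2 ^ r dvd k - k * u' * u" by (simp add: algebra_simps)
    qed
    from L_add[OF k this] have "w - of_int (k * u' * u) *\<^sub>R t \<in> L"
      by (simp add: scaleR_diff_left)
    then have "X = g (k * u')" by (simp only: w(2) g_def coset_eq_iff)
    also have "\<dots> = g ((k * u') mod 2 ^ r)" unfolding g_eq by (simp add: minus_mod_eq_mult_div)
    finally show ?thesis by (intro bexI[of _ "(k * u') mod 2 ^ r"]) auto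
  qed
  have g_iso: "g \<in> iso (integer_mod_group (2 ^ r)) (fst (disc_module L B))"
    unfolding iso_def mem_Collect_eq bij_betw_def carr
    using hom inj surj hom_in_carrier[OF hom] by (auto simp: carr)
  \<comment> \<open>\<open>g\<close> is periodic on the integers, so it is inverted on the standard
    residues.\<close>
  let ?f = "inv_into {0..<2 ^ r} g"
  have f_iso: "?f \<in> iso (fst (disc_module L B)) (fst (A_module r a))"
    using group.iso_set_sym[OF group_integer_mod_group g_iso] by (simp add: carr A_module_def)
  have "snd (A_module r a) (?f X) = snd (disc_module L B) X" if "X \<in> carrier (fst (disc_module L B))" for X
  proof -
    obtain j where j: "j \<in> {0..<2 ^ r}" "X = g j" using surj \<open>X \<in> _\<close> by blast
    have fX: "?f X = j" using inj j by simp
    let ?w = "of_int (j * u) *\<^sub>R t"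
    have "snd (disc_module L B) X = mod_int (B ?w ?w / 2)"
      unfolding j(2) g_def by (rule disc_module_form[OF lf even gD])
    also have "\<dots> = mod_int (of_int a / 2 ^ (r + 1) * (of_int j)\<^sup>2)"
      unfolding mod_int_eq_iff
    proof -
      have "B ?w ?w / 2 = of_int (j\<^sup>2 * (p * u\<^sup>2)) / 2 ^ (r + 1)"
        by (simp add: B_scale_left B_scale_right Bt power2_eq_square mult_ac)
      moreover have "of_int a / 2 ^ (r + 1) * (of_int j)\<^sup>2 = (of_int (j\<^sup>2 * a) / 2 ^ (r + 1) :: real)"
        by simp
      ultimately have "B ?w ?w / 2 - of_int a / 2 ^ (r + 1) * (of_int j)\<^sup>2
          = of_int (j\<^sup>2 * (p * u\<^sup>2 - a)) / 2 ^ (r + 1)"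
        by (simp only: of_int_diff right_diff_distrib diff_divide_distrib)
      also have "\<dots> = of_int (j\<^sup>2 * e)" by (simp add: e)
      finally show "B ?w ?w / 2 - of_int a / 2 ^ (r + 1) * (of_int j)\<^sup>2 \<in> \<int>"
        by (metis Ints_of_int)
    qed
    finally show ?thesis by (simp add: A_module_def fX)
  qed
  then show ?thesis using f_iso unfolding isometric_def by blast
qed

end

section \<open>Lattices given by Gram matrices\<close>

lemma int_basis_Basis: "int_basis Basis (int_vectors :: (real ^ 'n) set)"
  unfolding int_basis_def
proof (intro conjI finite_Basis independent_Basis subset_antisym subsetI)
  fix x :: "real ^ 'n" assume x: "x \<in> int_vectors"
  have "x \<bullet> b \<in> \<int>" if "b \<in> Basis" for b
    using x that by (auto simp: int_vectors_def Basis_vec_def inner_axis)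
  then have "(\<Sum>b\<in>Basis. of_int \<lfloor>x \<bullet> b\<rfloor> *\<^sub>R b) = x"
    by (simp add: euclidean_representation cong: sum.cong)
  then show "x \<in> {\<Sum>b\<in>Basis. of_int (c b) *\<^sub>R b | c :: real ^ 'n \<Rightarrow> int. True}"
    unfolding mem_Collect_eq by (intro exI[of _ "\<lambda>b. \<lfloor>x \<bullet> b\<rfloor>"]) simp
next
  fix x :: "real ^ 'n"
  assume "x \<in> {\<Sum>b\<in>Basis. of_int (c b) *\<^sub>R b | c :: real ^ 'n \<Rightarrow> int. True}"
  then obtain c :: "real ^ 'n \<Rightarrow> int" where x: "x = (\<Sum>b\<in>Basis. of_int (c b) *\<^sub>R b)" by blast
  have "b $ i \<in> \<int>" if "b \<in> Basis" for b :: "real ^ 'n" and i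
    using that by (auto simp: Basis_vec_def axis_def)
  then show "x \<in> int_vectors" by (auto simp: int_vectors_def x intro!: Ints_sum Ints_mult)
qed

lemma gram_form_sum: "gram_form G x y = (\<Sum>i\<in>UNIV. x $ i * (G *v y) $ i)"
  by (simp add: gram_form_def inner_vec_def)

lemma gram_form_axis: "gram_form G (axis i 1) y = (G *v y) $ i"
  by (simp add: gram_form_def inner_axis')

lemma gram_form_axis_axis: "gram_form G (axis i 1) (axis j 1) = G $ i $ j"
  by (simp add: gram_form_axis matrix_vector_mul_component inner_axis)

lemma bilinear_gram_form: "bilinear (gram_form G)"
  unfolding bilinear_def gram_form_def
  by (auto intro!: linearI simp: inner_add_left inner_add_right matrix_vector_right_distrib
      matrix_vector_mult_scaleR)

lemma gram_form_commute:
  assumes "\<And>i j. G $ i $ j = G $ j $ i"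
  shows "gram_form G x y = gram_form G y x"
proof -
  have "transpose G = G" using assms by (simp add: transpose_def vec_eq_iff)
  then show ?thesis unfolding gram_form_def
    by (metis dot_lmul_matrix inner_commute transpose_matrix_vector)
qed

text \<open>Both sides are Leibniz sums. Permutations of the index type are carried to permutations
  of \<open>Basis\<close> along \<open>i\<close> to \<open>axis i 1\<close>, which preserves
  signs.\<close>

lemma gram_det_Basis: "gram_det (gram_form G) (Basis :: (real ^ 'n) set) = det G"
proof -
  let ?f = "\<lambda>i :: 'n. axis i (1::real)"
  have inj: "inj ?f" by (simp add: inj_on_def axis_eq_axis)
  have rng: "range ?f = Basis" by (auto simp: Basis_vec_def)
  have bij: "bij_betw ?f UNIV Basis" using inj rng by (simp add: bij_betw_def)
  have perm: "bij_betw (map_permutation UNIV ?f) {p. p permutes UNIV} {p. p permutes Basis}"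
  proof (rule bij_betw_byWitness[of _ "map_permutation Basis (inv_into UNIV ?f)"])
    show "\<forall>p\<in>{p. p permutes UNIV}. map_permutation Basis (inv_into UNIV ?f) (map_permutation UNIV ?f p) = p"
      using bij inv_into_f_f[OF inj] by (auto intro!: map_permutation_compose_inv)
    show "\<forall>p\<in>{p. p permutes Basis}. map_permutation UNIV ?f (map_permutation Basis (inv_into UNIV ?f) p) = p"
      using bij_betw_inv_into[OF bij] f_inv_into_f[of _ ?f UNIV] rng
      by (auto intro!: map_permutation_compose_inv)
    show "map_permutation UNIV ?f ` {p. p permutes UNIV} \<subseteq> {p. p permutes Basis}"
      using map_permutation_permutes[OF bij] by auto
    show "map_permutation Basis (inv_into UNIV ?f) ` {p. p permutes Basis} \<subseteq> {p. p permutes UNIV}"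
      using map_permutation_permutes[OF bij_betw_inv_into[OF bij]] by auto
  qed
  have "gram_det (gram_form G) Basis
     = (\<Sum>p | p permutes (UNIV :: 'n set). of_int (sign (map_permutation UNIV ?f p)) *
         (\<Prod>s\<in>Basis. gram_form G s (map_permutation UNIV ?f p s)))"
    unfolding gram_det_def by (rule sum.reindex_bij_betw[OF perm, symmetric])
  also have "\<dots> = (\<Sum>p | p permutes (UNIV :: 'n set). of_int (sign p) * (\<Prod>i\<in>UNIV. G $ i $ p i))"
  proof (rule sum.cong[OF refl])
    fix p assume "p \<in> {p. p permutes (UNIV :: 'n set)}"
    then have p: "p permutes UNIV" by simp
    have "sign (map_permutation UNIV ?f p) = sign p"
      using p inj by (intro sign_map_permutation) auto
    moreover have "(\<Prod>s\<in>Basis. gram_form G s (map_permutation UNIV ?f p s))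
        = (\<Prod>i\<in>UNIV. gram_form G (?f i) (map_permutation UNIV ?f p (?f i)))"
      by (rule prod.reindex_bij_betw[OF bij, symmetric])
    moreover have "gram_form G (?f i) (map_permutation UNIV ?f p (?f i)) = G $ i $ p i" for i
      using map_permutation_apply[OF inj UNIV_I, of p i] by (simp add: gram_form_axis_axis)
    ultimately show "of_int (sign (map_permutation UNIV ?f p)) *
         (\<Prod>s\<in>Basis. gram_form G s (map_permutation UNIV ?f p s)) = of_int (sign p) * (\<Prod>i\<in>UNIV. G $ i $ p i)"
      by simp
  qed
  finally show ?thesis by (simp add: det_def)
qed

locale even_gram =
  fixes G :: "real ^ 'n ^ 'n"
  assumes symm: "G $ i $ j = G $ j $ i" and ints: "G $ i $ j \<in> \<int>"
    and diag: "G $ i $ i / 2 \<in> \<int>"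
    and pd: "x \<noteq> 0 \<Longrightarrow> gram_form G x x > 0"
begin

lemma gram_form_Ints:
  assumes "x \<in> int_vectors" "y \<in> int_vectors"
  shows "gram_form G x y \<in> \<int>"
  using assms ints unfolding gram_form_sum
  by (auto simp: int_vectors_def matrix_vector_mult_def intro!: Ints_sum Ints_mult)

text \<open>Off-diagonal entries enter a norm twice, so an even diagonal suffices. The induction
  adds one basis vector at a time and meets the cross term \<open>gram_form G ?z ?y\<close>, an
  integer.\<close>

lemma gram_form_half_Ints:
  assumes "x \<in> int_vectors"
  shows "gram_form G x x / 2 \<in> \<int>"
proof -
  obtain c :: "real ^ 'n \<Rightarrow> int" where x: "x = (\<Sum>b\<in>Basis. of_int (c b) *\<^sub>R b)"
    using assms int_basis_Basis by (auto simp: int_basis_def)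
  have "(\<Sum>b\<in>A. of_int (c b) *\<^sub>R b) \<in> int_vectors \<and>
      gram_form G (\<Sum>b\<in>A. of_int (c b) *\<^sub>R b) (\<Sum>b\<in>A. of_int (c b) *\<^sub>R b) / 2 \<in> \<int>"
    if "A \<subseteq> Basis" for A
    using finite_subset[OF that finite_Basis] that
  proof (induction A rule: finite_induct)
    case empty
    then show ?case by (simp add: int_vectors_def gram_form_def)
  next
    case (insert b A)
    let ?y = "\<Sum>b\<in>A. of_int (c b) *\<^sub>R b" and ?z = "of_int (c b) *\<^sub>R b"
    obtain i where b: "b = axis i 1" using insert.prems by (auto simp: Basis_vec_def)
    have z: "?z \<in> int_vectors" by (auto simp: int_vectors_def b axis_def)
    have y: "?y \<in> int_vectors" "gram_form G ?y ?y / 2 \<in> \<int>" using insert by auto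
    have "gram_form G ?z ?z / 2 = of_int (c b * c b) * (G $ i $ i / 2)"
      by (simp add: bilinear_lmul[OF bilinear_gram_form] bilinear_rmul[OF bilinear_gram_form]
          b gram_form_axis_axis)
    then have zz: "gram_form G ?z ?z / 2 \<in> \<int>" using diag by (metis Ints_mult Ints_of_int)
    have "gram_form G (?z + ?y) (?z + ?y) / 2
        = gram_form G ?z ?z / 2 + gram_form G ?y ?y / 2 + gram_form G ?z ?y"
      using gram_form_commute[OF symm, of ?y ?z]
      by (simp add: bilinear_ladd[OF bilinear_gram_form] bilinear_radd[OF bilinear_gram_form])
    also have "\<dots> \<in> \<int>" using y zz gram_form_Ints[OF z y(1)] by (intro Ints_add)
    finally have "gram_form G (?z + ?y) (?z + ?y) / 2 \<in> \<int>" .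
    moreover have "?z + ?y \<in> int_vectors" using z y by (auto simp: int_vectors_def)
    ultimately show ?case using insert.hyps by simp
  qed
  from this[of Basis] show ?thesis by (simp add: x)
qed

sublocale pos_even_lattice int_vectors "gram_form G" Basis
proof
  show "bilinear (gram_form G)" by (rule bilinear_gram_form)
  show "gram_form G x y = gram_form G y x" for x y by (rule gram_form_commute[OF symm])
  show "int_basis Basis (int_vectors :: (real ^ 'n) set)" by (rule int_basis_Basis)
  have "\<exists>k::int. gram_form G x x = 2 * of_int k" if x: "x \<in> int_vectors" for x
  proof -
    obtain k :: int where "gram_form G x x / 2 = of_int k"
      using gram_form_half_Ints[OF x] by (metis Ints_cases)
    then show ?thesis by (intro exI[of _ k]) simp
  qed
  then show "even_form int_vectors (gram_form G)" using gram_form_Ints by (auto simp: even_form_def)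
  show "pos_def_form int_vectors (gram_form G)" using pd by (auto simp: pos_def_form_def)
qed

lemma lattice_form_gram: "lattice_form int_vectors (gram_form G)"
proof -
  have "x = 0" if "G *v x = 0" for x
    using pd[of x] that by (auto simp: gram_form_def)
  then have "det G \<noteq> 0"
    by (metis invertible_det_nz invertible_left_inverse matrix_left_invertible_ker)
  then show ?thesis unfolding lattice_form_def
    using bilinear_gram_form gram_form_commute[OF symm] int_basis_Basis
    by (auto simp: gram_det_Basis)
qed

lemma dual_gram_Ints:
  assumes "w \<in> dual_lattice int_vectors (gram_form G)"
  shows "(G *v w) $ i \<in> \<int>"
proof -
  have "axis i 1 \<in> (int_vectors :: (real ^ 'n) set)" by (simp add: int_vectors_def axis_def)
  then have "gram_form G w (axis i 1) \<in> \<int>" using assms by (auto simp: dual_lattice_def)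
  then show ?thesis by (simp add: gram_form_axis gram_form_commute[OF symm, of w])
qed

lemma dual_gramI:
  assumes "\<And>i. (G *v w) $ i \<in> \<int>"
  shows "w \<in> dual_lattice int_vectors (gram_form G)"
proof -
  have "span int_vectors = (UNIV :: (real ^ 'n) set)" using span_S span_Basis by simp
  moreover have "gram_form G w y \<in> \<int>" if "y \<in> int_vectors" for y
    using assms that by (subst gram_form_commute[OF symm], unfold gram_form_sum)
 (auto simp: int_vectors_def intro!: Ints_sum Ints_mult)
  ultimately show ?thesis by (auto simp: dual_lattice_def)
qed

end

section \<open>Coordinates in dimensions 7 and 9\<close>

lemma vector_7:
  "(vector [a1,a2,a3,a4,a5,a6,a7] :: ('a::zero) ^ 7) $ 1 = a1"
  "(vector [a1,a2,a3,a4,a5,a6,a7] :: ('a::zero) ^ 7) $ 2 = a2"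
  "(vector [a1,a2,a3,a4,a5,a6,a7] :: ('a::zero) ^ 7) $ 3 = a3"
  "(vector [a1,a2,a3,a4,a5,a6,a7] :: ('a::zero) ^ 7) $ 4 = a4"
  "(vector [a1,a2,a3,a4,a5,a6,a7] :: ('a::zero) ^ 7) $ 5 = a5"
  "(vector [a1,a2,a3,a4,a5,a6,a7] :: ('a::zero) ^ 7) $ 6 = a6"
  "(vector [a1,a2,a3,a4,a5,a6,a7] :: ('a::zero) ^ 7) $ 7 = a7"
  unfolding vector_def by simp_all

text \<open>The numeral 7 is 0 in this type, so the representative \<open>z = 0\<close> is the index
  7.\<close>

lemma exhaust_7: "x = 1 \<or> x = 2 \<or> x = 3 \<or> x = 4 \<or> x = 5 \<or> x = 6 \<or> x = 7" for x :: 7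
proof (induct x)
  case (of_int z)
  then have "z \<in> {0..<7}" by simp
  then have "z = 0 \<or> z = 1 \<or> z = 2 \<or> z = 3 \<or> z = 4 \<or> z = 5 \<or> z = 6" by (simp add: atLeastLessThan_iff) presburger
  then show ?case by auto
qed

lemma forall_7: "(\<forall>i::7. P i) \<longleftrightarrow> P 1 \<and> P 2 \<and> P 3 \<and> P 4 \<and> P 5 \<and> P 6 \<and> P 7"
  by (metis exhaust_7)

lemma sum_7: "sum f (UNIV::7 set) = f 1 + f 2 + f 3 + f 4 + f 5 + f 6 + f 7"
proof -
  have U: "UNIV = {1, 2, 3, 4, 5, 6, 7::7}" using exhaust_7 by auto
  show ?thesis unfolding U by (simp add: add.assoc)
qed

lemma vector_9:
  "(vector [a1,a2,a3,a4,a5,a6,a7,a8,a9] :: ('a::zero) ^ 9) $ 1 = a1"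
  "(vector [a1,a2,a3,a4,a5,a6,a7,a8,a9] :: ('a::zero) ^ 9) $ 2 = a2"
  "(vector [a1,a2,a3,a4,a5,a6,a7,a8,a9] :: ('a::zero) ^ 9) $ 3 = a3"
  "(vector [a1,a2,a3,a4,a5,a6,a7,a8,a9] :: ('a::zero) ^ 9) $ 4 = a4"
  "(vector [a1,a2,a3,a4,a5,a6,a7,a8,a9] :: ('a::zero) ^ 9) $ 5 = a5"
  "(vector [a1,a2,a3,a4,a5,a6,a7,a8,a9] :: ('a::zero) ^ 9) $ 6 = a6"
  "(vector [a1,a2,a3,a4,a5,a6,a7,a8,a9] :: ('a::zero) ^ 9) $ 7 = a7"
  "(vector [a1,a2,a3,a4,a5,a6,a7,a8,a9] :: ('a::zero) ^ 9) $ 8 = a8"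
  "(vector [a1,a2,a3,a4,a5,a6,a7,a8,a9] :: ('a::zero) ^ 9) $ 9 = a9"
  unfolding vector_def by simp_all

lemma exhaust_9: "x = 1 \<or> x = 2 \<or> x = 3 \<or> x = 4 \<or> x = 5 \<or> x = 6 \<or> x = 7 \<or> x = 8 \<or> x = 9" for x :: 9
proof (induct x)
  case (of_int z)
  then have "z \<in> {0..<9}" by simp
  then have "z = 0 \<or> z = 1 \<or> z = 2 \<or> z = 3 \<or> z = 4 \<or> z = 5 \<or> z = 6 \<or> z = 7 \<or> z = 8" by (simp add: atLeastLessThan_iff) presburger
  then show ?case by auto
qed

lemma forall_9: "(\<forall>i::9. P i) \<longleftrightarrow> P 1 \<and> P 2 \<and> P 3 \<and> P 4 \<and> P 5 \<and> P 6 \<and> P 7 \<and> P 8 \<and> P 9"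
  by (metis exhaust_9)

lemma sum_9: "sum f (UNIV::9 set) = f 1 + f 2 + f 3 + f 4 + f 5 + f 6 + f 7 + f 8 + f 9"
proof -
  have U: "UNIV = {1, 2, 3, 4, 5, 6, 7, 8, 9::9}" using exhaust_9 by auto
  show ?thesis unfolding U by (simp add: add.assoc)
qed

context even_gram
begin

text \<open>The hypotheses are tailored to \<open>t\<close>, the vector \<open>axis i0 1\<close>
  divided by 2^r: \<open>corner\<close> yields its norm, \<open>col\<close> puts it into the dual
  lattice, and by \<open>dual\<close> a suitable multiple of \<open>t\<close> removes the only
  denominator of a dual vector.\<close>

lemma pos_def_even_lattice_with_A_module:
  fixes i0 :: 'n and p a :: int
  assumes corner: "G $ i0 $ i0 = of_int p * 2 ^ r" and p: "odd p" and ap: "[a = p] (mod 8)"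
    and col: "\<And>i. G $ i $ i0 / 2 ^ r \<in> \<int>"
    and dual: "\<And>w. (\<And>i. (G *v w) $ i \<in> \<int>) \<Longrightarrow> 2 ^ r * w $ i0 \<in> \<int> \<and> (\<forall>i. i \<noteq> i0 \<longrightarrow> w $ i \<in> \<int>)"
  shows "pos_def_even_lattice_with_disc (A_module r a) int_vectors (gram_form G)"
proof -
  define t :: "real ^ 'n" where "t = (1 / 2 ^ r) *\<^sub>R axis i0 1"
  have Gt: "(G *v t) $ i = G $ i $ i0 / 2 ^ r" for i
  proof -
    have "(G *v axis i0 1) $ i = G $ i $ i0"
      using gram_form_axis[of G i "axis i0 1"] gram_form_axis_axis[of G i i0] by simp
    then show ?thesis by (simp add: t_def matrix_vector_mult_scaleR)
  qed
  have tD: "t \<in> dual_lattice int_vectors (gram_form G)"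
    by (rule dual_gramI) (simp add: Gt col)
  have "gram_form G t t = of_int p / 2 ^ r"
    by (simp add: t_def B_scale_left B_scale_right gram_form_axis_axis corner)
  moreover have "2 ^ r *\<^sub>R t \<in> int_vectors" by (simp add: t_def int_vectors_def axis_def)
  moreover have "\<exists>k::int. w - of_int k *\<^sub>R t \<in> int_vectors"
    if w: "w \<in> dual_lattice int_vectors (gram_form G)" for w
  proof -
    have d: "2 ^ r * w $ i0 \<in> \<int>" "\<And>i. i \<noteq> i0 \<Longrightarrow> w $ i \<in> \<int>"
      using dual dual_gram_Ints[OF w] by auto
    obtain k :: int where "2 ^ r * w $ i0 = of_int k" using d(1) by (metis Ints_cases)
    then have "w $ i0 = of_int k / 2 ^ r" by (simp add: field_simps)
    then have "(w - of_int k *\<^sub>R t) $ i \<in> \<int>" for i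
      using d(2)[of i] by (cases "i = i0") (auto simp: t_def axis_def)
    then show ?thesis by (auto simp: int_vectors_def)
  qed
  ultimately have "isometric (disc_module int_vectors (gram_form G)) (A_module r a)"
    using isometric_A_moduleI[OF lattice_form_gram tD _ p ap] by blast
  then show ?thesis
    by (simp add: pos_def_even_lattice_with_disc_def lattice_form_gram even pos)
qed

end

section \<open>The three shapes of Gram matrices\<close>

lemma gram1_A_module:
  assumes r: "r > 0" and a: "[a = 1] (mod 8)"
  shows "pos_def_even_lattice_with_disc (A_module r a) int_vectors (gram_form (gram1 r))"
proof -
  have "\<forall>i j. gram1 r $ i $ j = 2 ^ r" unfolding forall_1 by (simp add: gram1_def)
  then have G: "gram1 r $ i $ j = 2 ^ r" for i j by blast
  have mult: "(gram1 r *v w) $ 1 = 2 ^ r * w $ 1" for w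
    by (simp add: matrix_vector_mult_def G sum_1)
  interpret even_gram "gram1 r"
  proof
    fix i j :: 1 and x :: "real ^ 1"
    show "gram1 r $ i $ j = gram1 r $ j $ i" "gram1 r $ i $ j \<in> \<int>" by (simp_all add: G)
    show "gram1 r $ i $ i / 2 \<in> \<int>" unfolding G using r by (cases r) simp_all
    assume "x \<noteq> 0"
    then have "x $ 1 \<noteq> 0" by (simp add: vec_eq_iff forall_1)
    moreover have "gram_form (gram1 r) x x = 2 ^ r * (x $ 1)\<^sup>2"
      by (simp add: gram_form_sum mult sum_1 power2_eq_square)
    ultimately show "gram_form (gram1 r) x x > 0" by simp
  qed
  show ?thesis
  proof (rule pos_def_even_lattice_with_A_module[of 1 1])
    show "2 ^ r * w $ 1 \<in> \<int> \<and> (\<forall>i. i \<noteq> 1 \<longrightarrow> w $ i \<in> \<int>)" if "\<And>i. (gram1 r *v w) $ i \<in> \<int>" for w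
      using that[of 1] by (simp add: mult forall_1)
  qed (use a in \<open>simp_all add: G\<close>)
qed

text \<open>Serves p = 19 and p = 7 together. The equation \<open>pc\<close> normalises the
  determinant to 2^r; it makes the last pivot positive and the elimination for dual vectors
  integral.\<close>

lemma gram7_A_module:
  fixes p c v a x' :: int
  assumes r: "r > 0" and p: "p > 0" and pc: "12 * c - 5 * p = 1"
    and px: "p * x' = 2 ^ (r - 1) * v\<^sup>2 + c" and x: "x = of_int x'" and a: "[a = p] (mod 8)"
  shows "pos_def_even_lattice_with_disc (A_module r a) int_vectors (gram_form (gram7 (of_int p) r v x))"
proof -
  define Q :: real where "Q = 2 ^ (r - 1)"
  have Q: "2 ^ r = 2 * Q" "Q > 0" "Q \<in> \<int>" using r by (simp_all add: Q_def flip: power_Suc)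
  define P where "P = real_of_int p"
  define V where "V = real_of_int v"
  define C where "C = real_of_int c"
  have intsP: "P \<in> \<int>" "V \<in> \<int>" "C \<in> \<int>" "x \<in> \<int>" by (simp_all add: P_def V_def C_def x)
  have P: "P > 0" using p by (simp add: P_def)
  have PC: "12 * C - 5 * P = 1"
    using arg_cong[OF pc, of real_of_int] by (simp add: P_def C_def)
  have PX: "P * x = Q * V\<^sup>2 + C"
    using arg_cong[OF px, of real_of_int] by (simp add: P_def C_def x V_def Q_def)
  let ?G = "gram7 P r v x"
  note entries = gram7_def vector_7 Q(1) V_def[symmetric]
  have mult: "(?G *v w) $ 1 = 2 * P * Q * w $ 1 + 2 * Q * V * w $ 2"
      "(?G *v w) $ 2 = 2 * Q * V * w $ 1 + 2 * x * w $ 2 + w $ 3"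
      "(?G *v w) $ 3 = w $ 2 + 2 * w $ 3 + w $ 4"
      "(?G *v w) $ 4 = w $ 3 + 2 * w $ 4 + w $ 5"
      "(?G *v w) $ 5 = w $ 4 + 2 * w $ 5 + w $ 6"
      "(?G *v w) $ 6 = w $ 5 + 2 * w $ 6 + w $ 7"
      "(?G *v w) $ 7 = w $ 6 + 2 * w $ 7" for w
    by (simp_all add: matrix_vector_mult_def sum_7 entries)
  interpret even_gram ?G
  proof
    have "\<forall>i j. ?G $ i $ j = ?G $ j $ i" unfolding forall_7 by (simp add: entries)
    then show "?G $ i $ j = ?G $ j $ i" for i j by blast
    have "\<forall>i j. ?G $ i $ j \<in> \<int>" unfolding forall_7 using intsP Q(3) by (simp add: entries)
    then show "?G $ i $ j \<in> \<int>" for i j by blast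
    have "\<forall>i. ?G $ i $ i / 2 \<in> \<int>" unfolding forall_7 using intsP Q(3) by (simp add: entries)
    then show "?G $ i $ i / 2 \<in> \<int>" for i by blast
    fix w :: "real ^ 7" assume w: "w \<noteq> 0"
    have x_eq: "x = (Q * V\<^sup>2 + C) / P" using PX P by (simp add: field_simps)
    have C_eq: "C = (1 + 5 * P) / 12" using PC by simp
    \<comment> \<open>The chain F_5 lowers \<open>2 * x\<close> by 5/6 = det F_4 / det F_5.
      Completing the square in \<open>w $ 1\<close> then leaves 2 C / P - 5 / 6 = (12 C - 5 P) / (6
      P) as coefficient of the square of \<open>w $ 2\<close>.\<close>
    have "2 * P * Q * (w $ 1)\<^sup>2 + 4 * Q * V * w $ 1 * w $ 2 + (2 * x - 5 / 6) * (w $ 2)\<^sup>2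
        = 2 * Q / P * (P * w $ 1 + V * w $ 2)\<^sup>2 + (w $ 2)\<^sup>2 / (6 * P)"
      unfolding x_eq C_eq using P by (simp add: field_simps power2_eq_square)
    \<comment> \<open>Squares are completed from the last coordinate upwards; the pivots 2, 3/2,
      4/3, 5/4, 6/5 are quotients of consecutive determinants of F_k.\<close>
    moreover have "gram_form ?G w w
        = (2 * P * Q * (w $ 1)\<^sup>2 + 4 * Q * V * w $ 1 * w $ 2 + (2 * x - 5 / 6) * (w $ 2)\<^sup>2)
        + 6 / 5 * (w $ 3 + 5 / 6 * w $ 2)\<^sup>2 + 5 / 4 * (w $ 4 + 4 / 5 * w $ 3)\<^sup>2
        + 4 / 3 * (w $ 5 + 3 / 4 * w $ 4)\<^sup>2 + 3 / 2 * (w $ 6 + 2 / 3 * w $ 5)\<^sup>2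
        + 2 * (w $ 7 + 1 / 2 * w $ 6)\<^sup>2"
      unfolding gram_form_sum sum_7 mult by (simp add: field_simps power2_eq_square)
    ultimately have form: "gram_form ?G w w
        = 2 * Q / P * (P * w $ 1 + V * w $ 2)\<^sup>2 + (w $ 2)\<^sup>2 / (6 * P)
        + 6 / 5 * (w $ 3 + 5 / 6 * w $ 2)\<^sup>2 + 5 / 4 * (w $ 4 + 4 / 5 * w $ 3)\<^sup>2
        + 4 / 3 * (w $ 5 + 3 / 4 * w $ 4)\<^sup>2 + 3 / 2 * (w $ 6 + 2 / 3 * w $ 5)\<^sup>2
        + 2 * (w $ 7 + 1 / 2 * w $ 6)\<^sup>2" by simp
    show "gram_form ?G w w > 0"
    proof (rule ccontr)
      assume neg: "\<not> gram_form ?G w w > 0"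
      have n1: "2 * Q / P * (P * w $ 1 + V * w $ 2)\<^sup>2 \<ge> 0" using P Q(2) by simp
      have n2: "(w $ 2)\<^sup>2 / (6 * P) \<ge> 0" using P by simp
      note nonneg = zero_le_power2[of "w $ 3 + 5 / 6 * w $ 2"] zero_le_power2[of "w $ 4 + 4 / 5 * w $ 3"]
        zero_le_power2[of "w $ 5 + 3 / 4 * w $ 4"] zero_le_power2[of "w $ 6 + 2 / 3 * w $ 5"]
        zero_le_power2[of "w $ 7 + 1 / 2 * w $ 6"]
      have "(w $ 2)\<^sup>2 / (6 * P) = 0" using neg form n1 n2 nonneg by linarith
      then have w2: "w $ 2 = 0" using P by simp
      have "2 * Q / P * (P * w $ 1 + V * w $ 2)\<^sup>2 = 0" using neg form n1 n2 nonneg by linarith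
      then have w1: "w $ 1 = 0" using P Q(2) w2 by simp
      have "(w $ 3 + 5 / 6 * w $ 2)\<^sup>2 = 0" using neg form n1 n2 nonneg by linarith
      then have w3: "w $ 3 = 0" using w2 by simp
      have "(w $ 4 + 4 / 5 * w $ 3)\<^sup>2 = 0" using neg form n1 n2 nonneg by linarith
      then have w4: "w $ 4 = 0" using w3 by simp
      have "(w $ 5 + 3 / 4 * w $ 4)\<^sup>2 = 0" using neg form n1 n2 nonneg by linarith
      then have w5: "w $ 5 = 0" using w4 by simp
      have "(w $ 6 + 2 / 3 * w $ 5)\<^sup>2 = 0" using neg form n1 n2 nonneg by linarith
      then have w6: "w $ 6 = 0" using w5 by simp
      have "(w $ 7 + 1 / 2 * w $ 6)\<^sup>2 = 0" using neg form n1 n2 nonneg by linarith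
      then have w7: "w $ 7 = 0" using w6 by simp
      show False using w w1 w2 w3 w4 w5 w6 w7 by (simp add: vec_eq_iff forall_7)
    qed
  qed
  have "pos_def_even_lattice_with_disc (A_module r a) int_vectors (gram_form ?G)"
  proof (rule pos_def_even_lattice_with_A_module[of 1 p])
    show "?G $ 1 $ 1 = of_int p * 2 ^ r" by (simp add: entries P_def)
    show "odd p" using pc by presburger
    show "[a = p] (mod 8)" by (rule a)
    have "\<forall>i. ?G $ i $ 1 / 2 ^ r \<in> \<int>" unfolding forall_7 using intsP Q(2) by (simp add: entries)
    then show "?G $ i $ 1 / 2 ^ r \<in> \<int>" for i by blast
    fix w assume "\<And>i. (?G *v w) $ i \<in> \<int>"
    note z = this[of 1] this[of 2] this[of 3] this[of 4] this[of 5] this[of 6] this[of 7]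
    \<comment> \<open>Modulo integers, rows 7 up to 3 give w6 = -2 w7, w5 = 3 w7, w4 = -4 w7, w3 = 5
      w7 and w2 = -6 w7.\<close>
    define A where "A = w $ 2 + 6 * w $ 7"
    define D where "D = w $ 3 - 5 * w $ 7"
    have "A = (?G *v w) $ 3 - 2 * (?G *v w) $ 4 + 3 * (?G *v w) $ 5 - 4 * (?G *v w) $ 6 + 5 * (?G *v w) $ 7"
      by (simp add: A_def mult)
    also have "\<dots> \<in> \<int>" using z by simp
    finally have A: "A \<in> \<int>" .
    have "D = (?G *v w) $ 4 - 2 * (?G *v w) $ 5 + 3 * (?G *v w) $ 6 - 4 * (?G *v w) $ 7"
      by (simp add: D_def mult)
    also have "\<dots> \<in> \<int>" using z by simp
    finally have D: "D \<in> \<int>" .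
    \<comment> \<open>This combination eliminates \<open>w $ 1\<close>. Inserting w2 and w3 in terms
      of w7 leaves \<open>w $ 7\<close> with the coefficient -(12 C - 5 P) = -1.\<close>
    have "P * (?G *v w) $ 2 - V * (?G *v w) $ 1 = 2 * (P * x - Q * V\<^sup>2) * w $ 2 + P * w $ 3"
      by (simp add: mult algebra_simps power2_eq_square)
    also have "\<dots> = 2 * C * A + P * D - (12 * C - 5 * P) * w $ 7"
      unfolding PX by (simp add: A_def D_def algebra_simps)
    finally have "w $ 7 = 2 * C * A + P * D - P * (?G *v w) $ 2 + V * (?G *v w) $ 1"
      unfolding PC by simp
    also have "\<dots> \<in> \<int>" using A D z intsP by simp
    finally have w7: "w $ 7 \<in> \<int>" .
    have "w $ 6 = (?G *v w) $ 7 - 2 * w $ 7" by (simp add: mult)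
    then have w6: "w $ 6 \<in> \<int>" using z w7 by simp
    have "w $ 5 = (?G *v w) $ 6 - 2 * w $ 6 - w $ 7" by (simp add: mult)
    then have w5: "w $ 5 \<in> \<int>" using z w6 w7 by simp
    have "w $ 4 = (?G *v w) $ 5 - 2 * w $ 5 - w $ 6" by (simp add: mult)
    then have w4: "w $ 4 \<in> \<int>" using z w5 w6 by simp
    have "w $ 3 = D + 5 * w $ 7" by (simp add: D_def)
    then have w3: "w $ 3 \<in> \<int>" using D w7 by simp
    have "w $ 2 = A - 6 * w $ 7" by (simp add: A_def)
    then have w2: "w $ 2 \<in> \<int>" using A w7 by simp
    \<comment> \<open>Multiplying by 1 = (12 x - 5) P - 12 Q V^2 expresses 2^r w1 through the w1
      terms of rows 1 and 2, which are integers because w2 and w3 already are.\<close>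
    have "2 ^ r * w $ 1 = (12 * C - 5 * P) * (2 * Q * w $ 1)" unfolding PC Q(1) by simp
    also have "12 * C - 5 * P = (12 * x - 5) * P - 12 * Q * V * V"
      using PX by (simp add: algebra_simps power2_eq_square)
    also have "\<dots> * (2 * Q * w $ 1) = (12 * x - 5) * ((?G *v w) $ 1 - 2 * Q * V * w $ 2)
        - 12 * Q * V * ((?G *v w) $ 2 - 2 * x * w $ 2 - w $ 3)"
      by (simp add: mult algebra_simps)
    also have "\<dots> \<in> \<int>" using z intsP Q(3) w2 w3 by simp
    finally show "2 ^ r * w $ 1 \<in> \<int> \<and> (\<forall>i. i \<noteq> 1 \<longrightarrow> w $ i \<in> \<int>)"
      unfolding forall_7 using w2 w3 w4 w5 w6 w7 by simp
  qed
  then show ?thesis by (simp only: P_def)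
qed

text \<open>The scheme of \<open>gram7_A_module\<close>, with 22 and 343 = 49 * 7 in place of 6 and
  5; the normalising equation is 44 * 39 - 5 * 343 = 1.\<close>

lemma gram9_A_module:
  fixes v a x' :: int
  assumes r: "r > 0"
    and px: "5 * x' = 2 ^ (r - 1) * v\<^sup>2 + 39" and x: "x = of_int x'" and a: "[a = 5] (mod 8)"
  shows "pos_def_even_lattice_with_disc (A_module r a) int_vectors (gram_form (gram9 r v x))"
proof -
  define Q :: real where "Q = 2 ^ (r - 1)"
  have Q: "2 ^ r = 2 * Q" "Q > 0" "Q \<in> \<int>" using r by (simp_all add: Q_def flip: power_Suc)
  define V where "V = real_of_int v"
  have intsP: "V \<in> \<int>" "x \<in> \<int>" by (simp_all add: V_def x)
  have PX: "5 * x = Q * V\<^sup>2 + 39"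
    using arg_cong[OF px, of real_of_int] by (simp add: x V_def Q_def)
  let ?G = "gram9 r v x"
  note entries = gram9_def vector_9 Q(1) V_def[symmetric]
  have mult: "(?G *v w) $ 1 = 10 * Q * w $ 1 + 2 * Q * V * w $ 2"
      "(?G *v w) $ 2 = 2 * Q * V * w $ 1 + 2 * x * w $ 2 + 7 * w $ 3"
      "(?G *v w) $ 3 = 7 * w $ 2 + 4 * w $ 3 + w $ 4"
      "(?G *v w) $ 4 = w $ 3 + 2 * w $ 4 + w $ 5"
      "(?G *v w) $ 5 = w $ 4 + 2 * w $ 5 + w $ 6"
      "(?G *v w) $ 6 = w $ 5 + 2 * w $ 6 + w $ 7"
      "(?G *v w) $ 7 = w $ 6 + 2 * w $ 7 + w $ 8"
      "(?G *v w) $ 8 = w $ 7 + 2 * w $ 8 + w $ 9"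
      "(?G *v w) $ 9 = w $ 8 + 2 * w $ 9" for w
    by (simp_all add: matrix_vector_mult_def sum_9 entries)
  interpret even_gram ?G
  proof
    have "\<forall>i j. ?G $ i $ j = ?G $ j $ i" unfolding forall_9 by (simp add: entries)
    then show "?G $ i $ j = ?G $ j $ i" for i j by blast
    have "\<forall>i j. ?G $ i $ j \<in> \<int>" unfolding forall_9 using intsP Q(3) by (simp add: entries)
    then show "?G $ i $ j \<in> \<int>" for i j by blast
    have "\<forall>i. ?G $ i $ i / 2 \<in> \<int>" unfolding forall_9 using intsP Q(3) by (simp add: entries)
    then show "?G $ i $ i / 2 \<in> \<int>" for i by blast
    fix w :: "real ^ 9" assume w: "w \<noteq> 0"
    have x_eq: "x = (Q * V\<^sup>2 + 39) / 5" using PX by simp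
    \<comment> \<open>The chain lowers \<open>2 * x\<close> by 49 * 7 / 22, and the last pivot is
      78/5 - 343/22 = 1/110.\<close>
    have "10 * Q * (w $ 1)\<^sup>2 + 4 * Q * V * w $ 1 * w $ 2 + (2 * x - 343 / 22) * (w $ 2)\<^sup>2
        = 2 * Q / 5 * (5 * w $ 1 + V * w $ 2)\<^sup>2 + (w $ 2)\<^sup>2 / 110"
      unfolding x_eq by (simp add: field_simps power2_eq_square)
    moreover have "gram_form ?G w w
        = (10 * Q * (w $ 1)\<^sup>2 + 4 * Q * V * w $ 1 * w $ 2 + (2 * x - 343 / 22) * (w $ 2)\<^sup>2)
        + 22 / 7 * (w $ 3 + 49 / 22 * w $ 2)\<^sup>2 + 7 / 6 * (w $ 4 + 6 / 7 * w $ 3)\<^sup>2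
        + 6 / 5 * (w $ 5 + 5 / 6 * w $ 4)\<^sup>2 + 5 / 4 * (w $ 6 + 4 / 5 * w $ 5)\<^sup>2
        + 4 / 3 * (w $ 7 + 3 / 4 * w $ 6)\<^sup>2 + 3 / 2 * (w $ 8 + 2 / 3 * w $ 7)\<^sup>2
        + 2 * (w $ 9 + 1 / 2 * w $ 8)\<^sup>2"
      unfolding gram_form_sum sum_9 mult by (simp add: field_simps power2_eq_square)
    ultimately have form: "gram_form ?G w w
        = 2 * Q / 5 * (5 * w $ 1 + V * w $ 2)\<^sup>2 + (w $ 2)\<^sup>2 / 110
        + 22 / 7 * (w $ 3 + 49 / 22 * w $ 2)\<^sup>2 + 7 / 6 * (w $ 4 + 6 / 7 * w $ 3)\<^sup>2
        + 6 / 5 * (w $ 5 + 5 / 6 * w $ 4)\<^sup>2 + 5 / 4 * (w $ 6 + 4 / 5 * w $ 5)\<^sup>2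
        + 4 / 3 * (w $ 7 + 3 / 4 * w $ 6)\<^sup>2 + 3 / 2 * (w $ 8 + 2 / 3 * w $ 7)\<^sup>2
        + 2 * (w $ 9 + 1 / 2 * w $ 8)\<^sup>2" by simp
    show "gram_form ?G w w > 0"
    proof (rule ccontr)
      assume neg: "\<not> gram_form ?G w w > 0"
      have n1: "2 * Q / 5 * (5 * w $ 1 + V * w $ 2)\<^sup>2 \<ge> 0" using Q(2) by simp
      note nonneg = n1 zero_le_power2[of "w $ 2"]
        zero_le_power2[of "w $ 3 + 49 / 22 * w $ 2"] zero_le_power2[of "w $ 4 + 6 / 7 * w $ 3"]
        zero_le_power2[of "w $ 5 + 5 / 6 * w $ 4"] zero_le_power2[of "w $ 6 + 4 / 5 * w $ 5"]
        zero_le_power2[of "w $ 7 + 3 / 4 * w $ 6"] zero_le_power2[of "w $ 8 + 2 / 3 * w $ 7"]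
        zero_le_power2[of "w $ 9 + 1 / 2 * w $ 8"]
      have "(w $ 2)\<^sup>2 = 0" using neg form nonneg by linarith
      then have w2: "w $ 2 = 0" by simp
      have "2 * Q / 5 * (5 * w $ 1 + V * w $ 2)\<^sup>2 = 0" using neg form nonneg by linarith
      then have w1: "w $ 1 = 0" using Q(2) w2 by simp
      have "(w $ 3 + 49 / 22 * w $ 2)\<^sup>2 = 0" using neg form nonneg by linarith
      then have w3: "w $ 3 = 0" using w2 by simp
      have "(w $ 4 + 6 / 7 * w $ 3)\<^sup>2 = 0" using neg form nonneg by linarith
      then have w4: "w $ 4 = 0" using w3 by simp
      have "(w $ 5 + 5 / 6 * w $ 4)\<^sup>2 = 0" using neg form nonneg by linarith
      then have w5: "w $ 5 = 0" using w4 by simp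
      have "(w $ 6 + 4 / 5 * w $ 5)\<^sup>2 = 0" using neg form nonneg by linarith
      then have w6: "w $ 6 = 0" using w5 by simp
      have "(w $ 7 + 3 / 4 * w $ 6)\<^sup>2 = 0" using neg form nonneg by linarith
      then have w7: "w $ 7 = 0" using w6 by simp
      have "(w $ 8 + 2 / 3 * w $ 7)\<^sup>2 = 0" using neg form nonneg by linarith
      then have w8: "w $ 8 = 0" using w7 by simp
      have "(w $ 9 + 1 / 2 * w $ 8)\<^sup>2 = 0" using neg form nonneg by linarith
      then have w9: "w $ 9 = 0" using w8 by simp
      show False using w w1 w2 w3 w4 w5 w6 w7 w8 w9 by (simp add: vec_eq_iff forall_9)
    qed
  qed
  show ?thesis
  proof (rule pos_def_even_lattice_with_A_module[of 1 5])
    show "?G $ 1 $ 1 = of_int 5 * 2 ^ r" by (simp add: entries)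
    show "odd (5::int)" by simp
    show "[a = 5] (mod 8)" by (rule a)
    have "\<forall>i. ?G $ i $ 1 / 2 ^ r \<in> \<int>" unfolding forall_9 using intsP Q(2) by (simp add: entries)
    then show "?G $ i $ 1 / 2 ^ r \<in> \<int>" for i by blast
    fix w assume "\<And>i. (?G *v w) $ i \<in> \<int>"
    note z = this[of 1] this[of 2] this[of 3] this[of 4] this[of 5] this[of 6] this[of 7]
      this[of 8] this[of 9]
    \<comment> \<open>Modulo integers, rows 9 up to 4 express w8, ..., w3 as multiples of w9 with
      the factors -2, 3, -4, 5, -6, 7. Row 3 then gives \<open>n3\<close>, and rows 1 and 2 with w1
      eliminated give \<open>n2\<close>.\<close>
    define D where "D = w $ 3 - 7 * w $ 9"
    have "D = (?G *v w) $ 4 - 2 * (?G *v w) $ 5 + 3 * (?G *v w) $ 6 - 4 * (?G *v w) $ 7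
        + 5 * (?G *v w) $ 8 - 6 * (?G *v w) $ 9"
      by (simp add: D_def mult)
    also have "\<dots> \<in> \<int>" using z by simp
    finally have D: "D \<in> \<int>" .
    define E where "E = w $ 4 + 6 * w $ 9"
    have "E = (?G *v w) $ 5 - 2 * (?G *v w) $ 6 + 3 * (?G *v w) $ 7 - 4 * (?G *v w) $ 8 + 5 * (?G *v w) $ 9"
      by (simp add: E_def mult)
    also have "\<dots> \<in> \<int>" using z by simp
    finally have E: "E \<in> \<int>" .
    define n3 where "n3 = 7 * w $ 2 + 22 * w $ 9"
    have "n3 = (?G *v w) $ 3 - 4 * D - E" by (simp add: n3_def mult D_def E_def)
    then have n3: "n3 \<in> \<int>" using z D E by simp
    define n2 where "n2 = 78 * w $ 2 + 245 * w $ 9"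
    have "5 * (?G *v w) $ 2 - V * (?G *v w) $ 1 = 2 * (5 * x - Q * V\<^sup>2) * w $ 2 + 35 * w $ 3"
      by (simp add: mult algebra_simps power2_eq_square)
    also have "\<dots> = n2 + 35 * D" unfolding PX by (simp add: n2_def D_def)
    finally have "n2 = 5 * (?G *v w) $ 2 - V * (?G *v w) $ 1 - 35 * D" by simp
    then have n2: "n2 \<in> \<int>" using z D intsP by simp
    \<comment> \<open>The passage from w2 and w9 to \<open>n3\<close> and \<open>n2\<close> has
      determinant 7 * 245 - 22 * 78 = -1, so its inverse is integral.\<close>
    have "w $ 2 = 22 * n2 - 245 * n3" by (simp add: n2_def n3_def)
    then have w2: "w $ 2 \<in> \<int>" using n2 n3 by simp
    have "w $ 9 = 78 * n3 - 7 * n2" by (simp add: n2_def n3_def)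
    then have w9: "w $ 9 \<in> \<int>" using n2 n3 by simp
    have "w $ 8 = (?G *v w) $ 9 - 2 * w $ 9" by (simp add: mult)
    then have w8: "w $ 8 \<in> \<int>" using z w9 by simp
    have "w $ 7 = (?G *v w) $ 8 - 2 * w $ 8 - w $ 9" by (simp add: mult)
    then have w7: "w $ 7 \<in> \<int>" using z w8 w9 by simp
    have "w $ 6 = (?G *v w) $ 7 - 2 * w $ 7 - w $ 8" by (simp add: mult)
    then have w6: "w $ 6 \<in> \<int>" using z w7 w8 by simp
    have "w $ 5 = (?G *v w) $ 6 - 2 * w $ 6 - w $ 7" by (simp add: mult)
    then have w5: "w $ 5 \<in> \<int>" using z w6 w7 by simp
    have "w $ 4 = E - 6 * w $ 9" by (simp add: E_def)
    then have w4: "w $ 4 \<in> \<int>" using E w9 by simp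
    have "w $ 3 = D + 7 * w $ 9" by (simp add: D_def)
    then have w3: "w $ 3 \<in> \<int>" using D w9 by simp
    have one: "(44 * x - 343) * 5 - 44 * Q * V * V = 1"
      using PX by (simp add: algebra_simps power2_eq_square)
    have "2 ^ r * w $ 1 = ((44 * x - 343) * 5 - 44 * Q * V * V) * (2 * Q * w $ 1)"
      unfolding one Q(1) by simp
    also have "\<dots> = (44 * x - 343) * ((?G *v w) $ 1 - 2 * Q * V * w $ 2)
        - 44 * Q * V * ((?G *v w) $ 2 - 2 * x * w $ 2 - 7 * w $ 3)"
      by (simp add: mult algebra_simps)
    also have "\<dots> \<in> \<int>" using z intsP Q(3) w2 w3 by simp
    finally show "2 ^ r * w $ 1 \<in> \<int> \<and> (\<forall>i. i \<noteq> 1 \<longrightarrow> w $ i \<in> \<int>)"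
      unfolding forall_9 using w2 w3 w4 w5 w6 w7 w8 w9 by simp
  qed
qed

section \<open>Rank bounds and assembly of the four cases\<close>

lemma pos_def_even_lattice_with_disc_rank:
  fixes L :: "'v::real_vector set"
  assumes lat: "pos_def_even_lattice_with_disc (A_module r a) L B" and odd: "odd r" and r: "r > 1"
  shows "[a = 1] (mod 8) \<Longrightarrow> 1 \<le> lattice_rank L"
    and "[a = 3] (mod 8) \<Longrightarrow> 7 \<le> lattice_rank L"
    and "[a = 5] (mod 8) \<Longrightarrow> 9 \<le> lattice_rank L"
    and "[a = 7] (mod 8) \<Longrightarrow> 7 \<le> lattice_rank L"
proof -
  have lf: "lattice_form L B" and iso: "isometric (disc_module L B) (A_module r a)"
    using lat by (auto simp: pos_def_even_lattice_with_disc_def)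
  obtain S where intb: "int_basis S L" using lf by (auto simp: lattice_form_def)
  interpret pos_even_lattice L B S
    using lat intb by unfold_locales (auto simp: pos_def_even_lattice_with_disc_def lattice_form_def)
  note rank = int_basis_rank[OF intb] and mod8 = rank_mod_8[OF lf iso odd]
  have a4: "a mod 4 = (a mod 8) mod 4" by (simp add: mod_mod_cancel)
  have ge_mod: "n mod 8 \<le> n" for n :: nat by simp
  show "1 \<le> lattice_rank L" if "[a = 1] (mod 8)"
  proof -
    have "a mod 4 = 1" using that a4 by (simp add: cong_def)
    then show ?thesis using mod8(1) ge_mod[of "card S"] by (simp add: rank)
  qed
  show "7 \<le> lattice_rank L" if "[a = 3] (mod 8)"
  proof -
    have "a mod 4 = 3" using that a4 by (simp add: cong_def)
    then show ?thesis using mod8(2) ge_mod[of "card S"] by (simp add: rank)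
  qed
  show "7 \<le> lattice_rank L" if "[a = 7] (mod 8)"
  proof -
    have "a mod 4 = 3" using that a4 by (simp add: cong_def)
    then show ?thesis using mod8(2) ge_mod[of "card S"] by (simp add: rank)
  qed
  show "9 \<le> lattice_rank L" if a: "[a = 5] (mod 8)"
  proof -
    have "a mod 4 = 1" "a mod 8 \<noteq> 1" using a a4 by (simp_all add: cong_def)
    moreover have "odd a" using a cong_dvd_modulus[OF a, of 2] by (simp add: cong_def odd_iff_mod_2_eq_one)
    ultimately have "card S mod 8 = 1" "card S \<noteq> 1" using mod8(1) rank_one_A_module[OF lf iso r] by auto
    moreover have "card S = 8 * (card S div 8) + card S mod 8" by simp
    ultimately have "9 \<le> card S" by (cases "card S div 8") auto
    then show ?thesis by (simp add: rank)
  qed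
qed

text \<open>The congruence on \<open>v\<close> makes \<open>x\<close> an integer, so that
  \<open>2 * x\<close> is an admissible diagonal entry of an even lattice.\<close>

lemma of_int_quotient:
  fixes n p c :: int
  assumes "[n = - c] (mod p)" "p > 0"
  obtains x' where "p * x' = n + c" "(of_int n + of_int c) / of_int p = (of_int x' :: real)"
proof -
  have "p dvd n + c" using assms(1) by (simp add: cong_iff_dvd_diff)
  then obtain x' where x': "n + c = p * x'" by blast
  have "(of_int n + of_int c :: real) = of_int p * of_int x'"
    using arg_cong[OF x', of real_of_int] by simp
  then show ?thesis using assms(2) x' by (intro that[of x']) auto
qed

theorem theorem5p9:
  fixes r :: nat and a :: int
  assumes "odd r" and "r > 1" and "odd a"
  shows
    "([a = 1] (mod 8) \<longrightarrow>
        pos_def_even_lattice_with_disc (A_module r a) int_vectors (gram_form (gram1 r)) \<and>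
        (\<forall>(L :: 'v::real_vector set) B. pos_def_even_lattice_with_disc (A_module r a) L B
           \<longrightarrow> lattice_rank (int_vectors :: (real ^ 1) set) \<le> lattice_rank L)) \<and>
     ([a = 3] (mod 8) \<longrightarrow>
        (\<forall>(v :: int) (x :: real).
           [2 ^ (r - 1) * v\<^sup>2 = -8] (mod 19) \<and> x = (2 ^ (r - 1) * (of_int v)\<^sup>2 + 8) / 19 \<longrightarrow>
           pos_def_even_lattice_with_disc (A_module r a) int_vectors (gram_form (gram7 19 r v x)) \<and>
           (\<forall>(L :: 'v::real_vector set) B. pos_def_even_lattice_with_disc (A_module r a) L B
              \<longrightarrow> lattice_rank (int_vectors :: (real ^ 7) set) \<le> lattice_rank L))) \<and>
     ([a = 5] (mod 8) \<longrightarrow>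
        (\<forall>(v :: int) (x :: real).
           [2 ^ (r - 1) * v\<^sup>2 = 1] (mod 5) \<and> x = (2 ^ (r - 1) * (of_int v)\<^sup>2 + 39) / 5 \<longrightarrow>
           pos_def_even_lattice_with_disc (A_module r a) int_vectors (gram_form (gram9 r v x)) \<and>
           (\<forall>(L :: 'v::real_vector set) B. pos_def_even_lattice_with_disc (A_module r a) L B
              \<longrightarrow> lattice_rank (int_vectors :: (real ^ 9) set) \<le> lattice_rank L))) \<and>
     ([a = 7] (mod 8) \<longrightarrow>
        (\<forall>(v :: int) (x :: real).
           [2 ^ (r - 1) * v\<^sup>2 = -3] (mod 7) \<and> x = (2 ^ (r - 1) * (of_int v)\<^sup>2 + 3) / 7 \<longrightarrow>
           pos_def_even_lattice_with_disc (A_module r a) int_vectors (gram_form (gram7 7 r v x)) \<and>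
           (\<forall>(L :: 'v::real_vector set) B. pos_def_even_lattice_with_disc (A_module r a) L B
              \<longrightarrow> lattice_rank (int_vectors :: (real ^ 7) set) \<le> lattice_rank L)))"
proof (intro conjI impI allI; (elim conjE)?)
  have r0: "r > 0" using assms by simp
  note rank = pos_def_even_lattice_with_disc_rank[OF _ assms(1,2)]
  {
    assume a: "[a = 1] (mod 8)"
    show "pos_def_even_lattice_with_disc (A_module r a) int_vectors (gram_form (gram1 r))"
      using r0 a by (rule gram1_A_module)
    show "lattice_rank (int_vectors :: (real ^ 1) set) \<le> lattice_rank L"
      if "pos_def_even_lattice_with_disc (A_module r a) L B" for L :: "'v set" and B
      using rank(1)[OF that a] by (simp add: lattice_rank_int_vectors)
  }
  {
    fix v :: int and x :: real
    assume a: "[a = 3] (mod 8)" and v: "[2 ^ (r - 1) * v\<^sup>2 = -8] (mod 19)"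
      and x: "x = (2 ^ (r - 1) * (of_int v)\<^sup>2 + 8) / 19"
    obtain x' where "19 * x' = 2 ^ (r - 1) * v\<^sup>2 + 8" "x = of_int x'"
      using v by (rule of_int_quotient) (use x in auto)
    moreover have "[a = 19] (mod 8)" using a by (simp add: cong_def)
    ultimately show "pos_def_even_lattice_with_disc (A_module r a) int_vectors (gram_form (gram7 19 r v x))"
      \<comment> \<open>The normalisation is 12 * 8 - 5 * 19 = 1.\<close>
      using gram7_A_module[of r 19 8 x' v x a] r0 by simp
    show "lattice_rank (int_vectors :: (real ^ 7) set) \<le> lattice_rank L"
      if "pos_def_even_lattice_with_disc (A_module r a) L B" for L :: "'v set" and B
      using rank(2)[OF that a] by (simp add: lattice_rank_int_vectors)
  }
  {
    fix v :: int and x :: real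
    assume a: "[a = 5] (mod 8)" and v: "[2 ^ (r - 1) * v\<^sup>2 = 1] (mod 5)"
      and x: "x = (2 ^ (r - 1) * (of_int v)\<^sup>2 + 39) / 5"
    \<comment> \<open>1 and -39 agree modulo 5; the shift 39 is the solution c of 44 c - 5 * 343 =
      1.\<close>
    have "[2 ^ (r - 1) * v\<^sup>2 = - 39] (mod 5)" using v by (simp add: cong_def)
    then obtain x' where "5 * x' = 2 ^ (r - 1) * v\<^sup>2 + 39" "x = of_int x'"
      by (rule of_int_quotient) (use x in auto)
    then show "pos_def_even_lattice_with_disc (A_module r a) int_vectors (gram_form (gram9 r v x))"
      using gram9_A_module[of r x' v x a] r0 a by simp
    show "lattice_rank (int_vectors :: (real ^ 9) set) \<le> lattice_rank L"
      if "pos_def_even_lattice_with_disc (A_module r a) L B" for L :: "'v set" and B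
      using rank(3)[OF that a] by (simp add: lattice_rank_int_vectors)
  }
  {
    fix v :: int and x :: real
    assume a: "[a = 7] (mod 8)" and v: "[2 ^ (r - 1) * v\<^sup>2 = -3] (mod 7)"
      and x: "x = (2 ^ (r - 1) * (of_int v)\<^sup>2 + 3) / 7"
    obtain x' where "7 * x' = 2 ^ (r - 1) * v\<^sup>2 + 3" "x = of_int x'"
      using v by (rule of_int_quotient) (use x in auto)
    then show "pos_def_even_lattice_with_disc (A_module r a) int_vectors (gram_form (gram7 7 r v x))"
      using gram7_A_module[of r 7 3 x' v x a] r0 a by simp
    show "lattice_rank (int_vectors :: (real ^ 7) set) \<le> lattice_rank L"
      if "pos_def_even_lattice_with_disc (A_module r a) L B" for L :: "'v set" and B
      using rank(4)[OF that a] by (simp add: lattice_rank_int_vectors)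
  }
qed

end
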